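(* Let $a<b$ be real numbers, let $\Omega_\varepsilon=(a,b)\times(0,\varepsilon)\subset\mathbb R^2$, and let $s_\varepsilon\in(0,\frac12)$ with $s_\varepsilon\to0$ as $\varepsilon\to0$ be such that the limit $\varrho=\lim_{\varepsilon\to0}\varepsilon^{s_\varepsilon}\in[0,1]$ exists. Let $$\lambda(s,\varepsilon)=\begin{cases}\varepsilon^{2-2s}s^{-1}&\text{if }\varrho=0,\\ \varepsilon^2s^{-1}&\text{if }\varrho\in(0,1),\\ \varepsilon^2|\log\varepsilon|&\text{if }\varrho=1.\end{cases}$$ Let $u:(a,b)\times(0,\varepsilon)\to\mathbb R$ be such that $u(x_1,x_2)=v(x_1)$, with $v:(a,b)\to\mathbb R$ piecewise constant. Then: (i) if $s_\varepsilon\gg|\log\varepsilon|^{-1}$, then $$\lim_{\varepsilon\to0}\frac1{\lambda(s_\varepsilon,\varepsilon)}\lfloor u\rfloor^2_{s_\varepsilon}(\Omega_\varepsilon)=\sum_{t\in S(v)}|v(t^+)-v(t^-)|^2;$$ (ii) if $s_\varepsilon\sim|\log\varepsilon|^{-1}$ (so that $\varrho\in(0,1)$), then $$\lim_{\varepsilon\to0}\frac1{\lambda(s_\varepsilon,\varepsilon)}\lfloor u\rfloor^2_{s_\varepsilon}(\Omega_\varepsilon)=\frac{1-\varrho^2}{\varrho^2}\sum_{t\in S(v)}|v(t^+)-v(t^-)|^2;$$ (iii) if $|\log\varepsilon|^{-1}\gg s_\varepsilon\gg\varepsilon^2|\log\varepsilon|^{-1}$, then $$\lim_{\varepsilon\to0}\frac1{\lambda(s_\varepsilon,\varepsilon)}\lfloor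 u\rfloor^2_{s_\varepsilon}(\Omega_\varepsilon)=2\sum_{t\in S(v)}|v(t^+)-v(t^-)|^2.$$
   Context: For measurable $A\subset\mathbb R^2$ and $s\in(0,1)$, $\lfloor u\rfloor_s^2(A)=\int_A\int_A\frac{|u(x)-u(y)|^2}{|x-y|^{2+2s}}\,dx\,dy$. A function $v:(a,b)\to\mathbb R$ is piecewise constant if $v=\sum_{j=1}^{N+1}\lambda_j\chi_{(a_{j-1},a_j)}$ (almost everywhere) for some finite partition $a=a_0<a_1<\dots<a_{N+1}=b$ and $\lambda_j\in\mathbb R$. $S(v)$ is its (finite) jump set in $(a,b)$, and $v(t^\pm)$ are the right and left limits at $t$. For positive quantities, $\alpha_\varepsilon\gg\beta_\varepsilon$ means $\beta_\varepsilon/\alpha_\varepsilon\to0$ as $\varepsilon\to0$, and $s_\varepsilon\sim|\log\varepsilon|^{-1}$ means that $s_\varepsilon|\log\varepsilon|$ converges to a limit in $(0,+\infty)$. The cases $s_\varepsilon\gg|\log\varepsilon|^{-1}$, $s_\varepsilon\sim|\log\varepsilon|^{-1}$, $s_\varepsilon\ll|\log\varepsilon|^{-1}$ correspond respectively to $\varrho=0$, $\varrho\in(0,1)$, $\varrho=1$. *)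

theory Defs
  imports "HOL-Analysis.Analysis"
begin

text \<open>The squared seminorm is a Lebesgue integral of a nonnegative function, hence \<open>ennreal\<close>-valued:
  no integrability is presupposed.  On \<open>real \<times> real\<close> the norm is the Euclidean one.\<close>

definition gagliardo_sq :: "real \<Rightarrow> (real \<times> real) set \<Rightarrow> (real \<times> real \<Rightarrow> real) \<Rightarrow> ennreal" where
  "gagliardo_sq s A u =
     (\<integral>\<^sup>+ y\<in>A. (\<integral>\<^sup>+ x\<in>A. ennreal (\<bar>u x - u y\<bar>\<^sup>2 / norm (x - y) powr (2 + 2 * s)) \<partial>lebesgue) \<partial>lebesgue)"

definition thin_film :: "real \<Rightarrow> real \<Rightarrow> real \<Rightarrow> (real \<times> real) set" where
  "thin_film a b \<epsilon> = {a<..<b} \<times> {0<..<\<epsilon>}"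

definition piecewise_constant_on :: "real \<Rightarrow> real \<Rightarrow> (real \<Rightarrow> real) \<Rightarrow> bool" where
  "piecewise_constant_on a b v \<longleftrightarrow>
     (\<exists>(N::nat) (p::nat \<Rightarrow> real) (c::nat \<Rightarrow> real).
        p 0 = a \<and> p (N + 1) = b \<and> (\<forall>j\<in>{1..N+1}. p (j - 1) < p j) \<and>
        (AE x in lebesgue. x \<in> {a<..<b} \<longrightarrow>
           v x = (\<Sum>j=1..N+1. c j * indicator {p (j - 1)<..<p j} x)))"

text \<open>A piecewise constant function is determined only up to null sets, so its one-sided limits are
  taken modulo null sets: \<open>(v \<longlongrightarrow> l) (ess_at_right t)\<close> says that for every neighbourhood \<open>U\<close> of \<open>l\<close>
  there is \<open>\<delta> > 0\<close> with \<open>v x \<in> U\<close> for almost every \<open>x \<in> (t, t + \<delta>)\<close>.\<close>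

definition ess_at_right :: "real \<Rightarrow> real filter" where
  "ess_at_right t = inf (at_right t) (ae_filter lebesgue)"

definition ess_at_left :: "real \<Rightarrow> real filter" where
  "ess_at_left t = inf (at_left t) (ae_filter lebesgue)"

definition right_lim :: "(real \<Rightarrow> real) \<Rightarrow> real \<Rightarrow> real" where
  "right_lim v t = Lim (ess_at_right t) v"

definition left_lim :: "(real \<Rightarrow> real) \<Rightarrow> real \<Rightarrow> real" where
  "left_lim v t = Lim (ess_at_left t) v"

definition jump_set :: "real \<Rightarrow> real \<Rightarrow> (real \<Rightarrow> real) \<Rightarrow> real set" where
  "jump_set a b v =
     {t \<in> {a<..<b}. \<exists>l r. (v \<longlongrightarrow> l) (ess_at_left t) \<and> (v \<longlongrightarrow> r) (ess_at_right t) \<and> l \<noteq> r}"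

text \<open>The asymptotic relations between positive quantities as \<open>\<epsilon> \<rightarrow> 0\<^sup>+\<close>:
  \<open>\<alpha> \<ggreater> \<beta>\<close>, and \<open>s\<^sub>\<epsilon> \<sim> |log \<epsilon>|\<^sup>-\<^sup>1\<close>; the latter is not asymptotic equality, as the limit of
  the ratio may be any positive number.\<close>

definition much_greater :: "(real \<Rightarrow> real) \<Rightarrow> (real \<Rightarrow> real) \<Rightarrow> bool" where
  "much_greater \<alpha> \<beta> \<longleftrightarrow> ((\<lambda>\<epsilon>. \<beta> \<epsilon> / \<alpha> \<epsilon>) \<longlongrightarrow> 0) (at_right 0)"

definition comparable_inverse_log :: "(real \<Rightarrow> real) \<Rightarrow> bool" where
  "comparable_inverse_log s \<longleftrightarrow> (\<exists>c>0. ((\<lambda>\<epsilon>. s \<epsilon> * \<bar>ln \<epsilon>\<bar>) \<longlongrightarrow> c) (at_right 0))"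

text \<open>The scaling factor; the parameter \<open>\<rho>\<close> is the limit of \<open>\<epsilon> powr s\<^sub>\<epsilon>\<close>, always in \<open>[0, 1]\<close>.\<close>

definition scaling :: "real \<Rightarrow> real \<Rightarrow> real \<Rightarrow> real" where
  "scaling \<rho> s \<epsilon> =
     (if \<rho> = 0 then \<epsilon> powr (2 - 2 * s) / s
      else if \<rho> < 1 then \<epsilon>\<^sup>2 / s
      else \<epsilon>\<^sup>2 * \<bar>ln \<epsilon>\<bar>)"

end

theory Submission
  imports Defs "HOL-Real_Asymp.Real_Asymp"
begin

text \<open>Up to a null set, \<open>v\<close> is a constant plus a finite sum of Heaviside functions with jumps \<open>d t\<close> at
  \<open>t \<in> P\<close>.  Let \<open>M\<close> be smaller than all gaps between the points of \<open>P\<close> and the end points.  For a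
  horizontal increment \<open>\<bar>h\<bar> \<le> M\<close> at most one jump is crossed, so \<open>(v (x + h) - v x)\<^sup>2\<close> integrates in \<open>x\<close>
  to exactly \<open>\<bar>h\<bar> * S\<close>, where \<open>S\<close> is the sum of the squared jumps.  By Tonelli the near part of the
  seminorm is \<open>S\<close> times the integral over \<open>(0, \<epsilon>)\<^sup>2\<close> of the explicit function
  \<open>(\<bar>z\<bar> powr (- 2 * s) - (M\<^sup>2 + z\<^sup>2) powr (- s)) / s\<close> of \<open>z = x\<^sub>2 - y\<^sub>2\<close>, whose second term lies between two
  constants as \<open>\<bar>z\<bar> \<le> \<epsilon> \<le> M\<close>.  The increments with \<open>\<bar>h\<bar> > M\<close> contribute \<open>O(\<epsilon>\<^sup>2)\<close>, which is negligible in
  all three regimes.  In terms of \<open>r = \<epsilon> powr s\<close> this leaves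
  \<open>\<epsilon>\<^sup>2 / s * S * (1 / r\<^sup>2 - 1)\<close> to leading order.\<close>

subsection \<open>Reduction to horizontal increments\<close>

lemma power2_powr_uminus:
  fixes x s :: real
  assumes "0 < x"
  shows "(x\<^sup>2) powr (- s) = x powr (- 2 * s)"
proof -
  have "x\<^sup>2 = x powr 2"
    using assms by simp
  then show ?thesis
    by (simp only: powr_powr) simp
qed

text \<open>The cylinder over a null set is null although its second factor has infinite measure,
  because \<open>0 * top = 0\<close> in \<open>ennreal\<close>. This lifts almost everywhere
  statements about \<open>v\<close> on the line to the plane.\<close>

lemma AE_lborel_fst:
  assumes "AE x in (lborel :: 'a::euclidean_space measure). P x"
  shows "AE z in (lborel :: ('a \<times> 'b::euclidean_space) measure). P (fst z)"
proof -
  obtain N where N: "N \<in> null_sets lborel" "{x. \<not> P x} \<subseteq> N"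
    using assms unfolding eventually_ae_filter by auto
  have "emeasure (lborel \<Otimes>\<^sub>M lborel) (N \<times> (UNIV :: 'b set)) = emeasure lborel N * emeasure lborel (UNIV :: 'b set)"
    using N(1) by (intro lborel.emeasure_pair_measure_Times) auto
  moreover have "N \<times> (UNIV :: 'b set) \<in> sets (lborel \<Otimes>\<^sub>M lborel)"
    using N(1) by (intro pair_measureI) auto
  ultimately have "N \<times> (UNIV :: 'b set) \<in> null_sets (lborel \<Otimes>\<^sub>M lborel)"
    using N(1) by (auto simp: null_sets_def)
  then show ?thesis
    using N(2) unfolding lborel_prod eventually_ae_filter by (intro bexI[of _ "N \<times> UNIV"]) auto
qed

text \<open>The singular kernel at a fixed horizontal increment \<open>h\<close>, integrated over
  both vertical variables.\<close>

definition film_kernel :: "real \<Rightarrow> real \<Rightarrow> real \<Rightarrow> ennreal" where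
  "film_kernel s \<epsilon> h = (\<integral>\<^sup>+ y. (\<integral>\<^sup>+ x. ennreal ((h\<^sup>2 + (x - y)\<^sup>2) powr (- (1 + s))) *
      indicator {0<..<\<epsilon>} x \<partial>lborel) * indicator {0<..<\<epsilon>} y \<partial>lborel)"

definition increment_sq :: "real \<Rightarrow> real \<Rightarrow> (real \<Rightarrow> real) \<Rightarrow> real \<Rightarrow> ennreal" where
  "increment_sq a b w h = (\<integral>\<^sup>+ x. ennreal ((w (x + h) - w x)\<^sup>2) *
      indicator {a<..<b} (x + h) * indicator {a<..<b} x \<partial>lborel)"

lemma film_kernel_measurable [measurable]: "film_kernel s \<epsilon> \<in> borel_measurable borel"
  unfolding film_kernel_def by measurable

lemma increment_sq_measurable [measurable]:
  assumes [measurable]: "w \<in> borel_measurable borel"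
  shows "increment_sq a b w \<in> borel_measurable borel"
  unfolding increment_sq_def by measurable

lemma norm_Pair_powr:
  fixes h z s :: real
  shows "c / norm (h, z) powr (2 + 2 * s) = c * (h\<^sup>2 + z\<^sup>2) powr (- (1 + s))"
proof (cases "h = 0 \<and> z = 0")
  \<comment> \<open>At the origin both sides are 0, since \<open>0 powr _ = 0\<close> and division
    by zero yields zero.\<close>
  case True
  then show ?thesis by simp
next
  case False
  then have pos: "h\<^sup>2 + z\<^sup>2 > 0"
    by (simp add: sum_power2_gt_zero_iff)
  have "norm (h, z) powr (2 + 2 * s) = (h\<^sup>2 + z\<^sup>2) powr (1 + s)"
    using pos by (simp add: norm_Pair powr_half_sqrt[symmetric] powr_powr algebra_simps)
  then show ?thesis
    by (simp only: powr_minus_divide) simp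
qed

text \<open>The difference of \<open>u\<close> sees only the horizontal variables and the kernel
  only the two increments. Hence Tonelli and the translation \<open>x1 = y1 + h\<close> reduce the
  seminorm to one integral over \<open>h\<close>. Replacing \<open>u\<close> by the Borel
  representative \<open>w\<close> first supplies the measurability that Tonelli requires.\<close>

lemma gagliardo_sq_thin_film:
  assumes w [measurable]: "w \<in> borel_measurable borel"
    and ae: "AE x in lebesgue. x \<in> {a<..<b} \<longrightarrow> v x = w x"
    and u: "\<And>x1 x2. (x1, x2) \<in> thin_film a b \<epsilon> \<Longrightarrow> u (x1, x2) = v x1"
  shows "gagliardo_sq s (thin_film a b \<epsilon>) u = (\<integral>\<^sup>+ h. increment_sq a b w h * film_kernel s \<epsilon> h \<partial>lborel)"
proof -
  let ?A = "thin_film a b \<epsilon>"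
  let ?I = "indicator {a<..<b} :: real \<Rightarrow> ennreal"
  let ?J = "indicator {0<..<\<epsilon>} :: real \<Rightarrow> ennreal"
  let ?k = "\<lambda>h z. ennreal ((h\<^sup>2 + z\<^sup>2) powr (- (1 + s)))"
  let ?d = "\<lambda>x y. ennreal ((w x - w y)\<^sup>2) * ?I x * ?I y"
  define g where "g x y = ?d (fst x) (fst y) * (?k (fst x - fst y) (snd x - snd y) * ?J (snd x) * ?J (snd y))" for x y :: "real \<times> real"
  have g_meas [measurable]: "case_prod g \<in> borel_measurable ((lborel \<Otimes>\<^sub>M lborel) \<Otimes>\<^sub>M (lborel \<Otimes>\<^sub>M lborel))"
    unfolding g_def by measurable
  \<comment> \<open>Naming the inner vertical integral makes its joint measurability available when
    the horizontal and vertical integrations are interchanged.\<close>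
  define Q where "Q h y2 = (\<integral>\<^sup>+ x2. ?k h (x2 - y2) * ?J x2 \<partial>lborel) * ?J y2" for h y2
  have Q_meas [measurable]: "case_prod Q \<in> borel_measurable (borel \<Otimes>\<^sub>M borel)"
    unfolding Q_def by measurable
  have aeu: "AE z in lebesgue. z \<in> ?A \<longrightarrow> u z = w (fst z)"
  proof -
    have "AE x in lborel. x \<in> {a<..<b} \<longrightarrow> v x = w x"
      using ae by (simp add: AE_completion_iff)
    from AE_lborel_fst[OF this, where 'b = real]
    have "AE z in lebesgue. fst z \<in> {a<..<b} \<longrightarrow> v (fst z) = w (fst (z :: real \<times> real))"
      by (rule AE_completion)
    then show ?thesis
    proof eventually_elim
      case (elim z)
      then show ?case
        using u[of "fst z" "snd z"] by (auto simp: thin_film_def)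
    qed
  qed
  have pt: "ennreal (\<bar>u x - u y\<bar>\<^sup>2 / norm (x - y) powr (2 + 2 * s)) * indicator ?A x * indicator ?A y = g x y"
    if "x \<in> ?A \<longrightarrow> u x = w (fst x)" "y \<in> ?A \<longrightarrow> u y = w (fst y)" for x y
  proof (cases "x \<in> ?A \<and> y \<in> ?A")
    case True
    have n: "norm (x - y) = norm (fst x - fst y, snd x - snd y)"
      by (simp add: prod_eq_iff norm_prod_def)
    show ?thesis
      using True that unfolding n norm_Pair_powr
      by (auto simp: g_def thin_film_def indicator_def ennreal_mult)
  next
    case False
    then show ?thesis
      by (auto simp: g_def thin_film_def indicator_def mem_Times_iff split: if_splits)
  qed
  have "gagliardo_sq s ?A u = (\<integral>\<^sup>+ y. (\<integral>\<^sup>+ x. ennreal (\<bar>u x - u y\<bar>\<^sup>2 / norm (x - y) powr (2 + 2 * s)) * indicator ?A x \<partial>lebesgue) * indicator ?A y \<partial>lebesgue)"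
    unfolding gagliardo_sq_def ..
  also have "\<dots> = (\<integral>\<^sup>+ y. (\<integral>\<^sup>+ x. ennreal (\<bar>u x - u y\<bar>\<^sup>2 / norm (x - y) powr (2 + 2 * s)) * indicator ?A x * indicator ?A y \<partial>lebesgue) \<partial>lebesgue)"
    by (intro nn_integral_cong) (auto simp: indicator_def)
  \<comment> \<open>The exceptional set is the same null set for both variables: first a good
    \<open>y\<close> is fixed, then almost every \<open>x\<close> is good.\<close>
  also have "\<dots> = (\<integral>\<^sup>+ y. (\<integral>\<^sup>+ x. g x y \<partial>lebesgue) \<partial>lebesgue)"
  proof (rule nn_integral_cong_AE, use aeu in eventually_elim)
    case (elim y)
    show ?case
      by (rule nn_integral_cong_AE, use aeu in eventually_elim) (rule pt[OF _ elim])
  qed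
  also have "\<dots> = (\<integral>\<^sup>+ y. (\<integral>\<^sup>+ x. g x y \<partial>(lborel \<Otimes>\<^sub>M lborel)) \<partial>(lborel \<Otimes>\<^sub>M lborel))"
    by (simp add: nn_integral_completion lborel_prod)
  also have "\<dots> = (\<integral>\<^sup>+ y. (\<integral>\<^sup>+ x1. (\<integral>\<^sup>+ x2. g (x1, x2) y \<partial>lborel) \<partial>lborel) \<partial>(lborel \<Otimes>\<^sub>M lborel))"
    by (intro nn_integral_cong lborel.nn_integral_fst[symmetric]) measurable
  also have "\<dots> = (\<integral>\<^sup>+ y1. (\<integral>\<^sup>+ y2. (\<integral>\<^sup>+ x1. (\<integral>\<^sup>+ x2. g (x1, x2) (y1, y2) \<partial>lborel) \<partial>lborel) \<partial>lborel) \<partial>lborel)"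
    unfolding g_def by (intro lborel.nn_integral_fst[symmetric]) measurable
  also have "\<dots> = (\<integral>\<^sup>+ y1. (\<integral>\<^sup>+ y2. (\<integral>\<^sup>+ x1. ?d x1 y1 * Q (x1 - y1) y2 \<partial>lborel) \<partial>lborel) \<partial>lborel)"
  proof (intro nn_integral_cong)
    fix x1 y1 y2 :: real
    show "(\<integral>\<^sup>+ x2. g (x1, x2) (y1, y2) \<partial>lborel) = ?d x1 y1 * Q (x1 - y1) y2"
      unfolding g_def fst_conv snd_conv Q_def
      by (subst nn_integral_cmult, measurable, subst nn_integral_multc, measurable)
  qed
  also have "\<dots> = (\<integral>\<^sup>+ y1. (\<integral>\<^sup>+ x1. (\<integral>\<^sup>+ y2. ?d x1 y1 * Q (x1 - y1) y2 \<partial>lborel) \<partial>lborel) \<partial>lborel)"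
  proof (rule nn_integral_cong)
    fix y1 :: real
    show "(\<integral>\<^sup>+ y2. (\<integral>\<^sup>+ x1. ?d x1 y1 * Q (x1 - y1) y2 \<partial>lborel) \<partial>lborel) =
        (\<integral>\<^sup>+ x1. (\<integral>\<^sup>+ y2. ?d x1 y1 * Q (x1 - y1) y2 \<partial>lborel) \<partial>lborel)"
      by (rule lborel_pair.Fubini'[where f = "\<lambda>x1 y2. ?d x1 y1 * Q (x1 - y1) y2"]) measurable
  qed
  also have "\<dots> = (\<integral>\<^sup>+ y1. (\<integral>\<^sup>+ x1. ?d x1 y1 * film_kernel s \<epsilon> (x1 - y1) \<partial>lborel) \<partial>lborel)"
  proof (intro nn_integral_cong)
    fix x1 y1 :: real
    show "(\<integral>\<^sup>+ y2. ?d x1 y1 * Q (x1 - y1) y2 \<partial>lborel) = ?d x1 y1 * film_kernel s \<epsilon> (x1 - y1)"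
      unfolding film_kernel_def Q_def[symmetric] by (rule nn_integral_cmult) measurable
  qed
  also have "\<dots> = (\<integral>\<^sup>+ y. (\<integral>\<^sup>+ h. ?d (y + h) y * film_kernel s \<epsilon> h \<partial>lborel) \<partial>lborel)"
  proof (rule nn_integral_cong)
    fix y :: real
    show "(\<integral>\<^sup>+ x. ?d x y * film_kernel s \<epsilon> (x - y) \<partial>lborel) = (\<integral>\<^sup>+ h. ?d (y + h) y * film_kernel s \<epsilon> h \<partial>lborel)"
      by (subst nn_integral_real_affine[where c = 1 and t = y]) auto
  qed
  also have "\<dots> = (\<integral>\<^sup>+ h. (\<integral>\<^sup>+ y. ?d (y + h) y * film_kernel s \<epsilon> h \<partial>lborel) \<partial>lborel)"
    by (rule lborel_pair.Fubini'[where f = "\<lambda>h y. ?d (y + h) y * film_kernel s \<epsilon> h"]) measurable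
  also have "\<dots> = (\<integral>\<^sup>+ h. increment_sq a b w h * film_kernel s \<epsilon> h \<partial>lborel)"
    unfolding increment_sq_def by (intro nn_integral_cong nn_integral_multc) measurable
  finally show ?thesis .
qed

subsection \<open>Jumps of piecewise constant functions\<close>

text \<open>Every interval to the right of \<open>t\<close> has positive measure, so no null set
  contains it. Nontriviality of the filter makes essential limits unique, so that \<open>Lim\<close>
  returns the actual limit.\<close>

lemma ess_at_right_neq_bot: "ess_at_right t \<noteq> bot"
proof
  assume "ess_at_right t = bot"
  then have "eventually (\<lambda>x. False) (inf (at_right t) (ae_filter lebesgue))"
    by (simp add: ess_at_right_def)
  then obtain P Q where P: "eventually P (at_right t)" and Q: "AE x in lebesgue. Q x"
    and PQ: "\<And>x. P x \<Longrightarrow> Q x \<Longrightarrow> False"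
    unfolding eventually_inf by auto
  obtain r where r: "r > t" "\<And>x. t < x \<Longrightarrow> x < r \<Longrightarrow> P x"
    using P unfolding eventually_at_right_field by auto
  have "AE x in lborel. Q x"
    using Q by (simp add: AE_completion_iff)
  then have "AE x in lborel. x \<notin> {t<..<r}"
    by eventually_elim (use r PQ in auto)
  then have "emeasure lborel {t<..<r} = 0"
    by (subst (asm) AE_iff_null_sets[symmetric]) auto
  with r show False
    by simp
qed

lemma ess_at_left_neq_bot: "ess_at_left t \<noteq> bot"
proof
  assume "ess_at_left t = bot"
  then have "eventually (\<lambda>x. False) (inf (at_left t) (ae_filter lebesgue))"
    by (simp add: ess_at_left_def)
  then obtain P Q where P: "eventually P (at_left t)" and Q: "AE x in lebesgue. Q x"
    and PQ: "\<And>x. P x \<Longrightarrow> Q x \<Longrightarrow> False"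
    unfolding eventually_inf by auto
  obtain r where r: "r < t" "\<And>x. r < x \<Longrightarrow> x < t \<Longrightarrow> P x"
    using P unfolding eventually_at_left_field by auto
  have "AE x in lborel. Q x"
    using Q by (simp add: AE_completion_iff)
  then have "AE x in lborel. x \<notin> {r<..<t}"
    by eventually_elim (use r PQ in auto)
  then have "emeasure lborel {r<..<t} = 0"
    by (subst (asm) AE_iff_null_sets[symmetric]) auto
  with r show False
    by simp
qed

text \<open>The open half-lines fix the left-continuous representative; an increment by
  \<open>h >= 0\<close> of a single step is then exactly the indicator of a half-open
  interval.\<close>

definition heaviside_sum :: "real set \<Rightarrow> (real \<Rightarrow> real) \<Rightarrow> real \<Rightarrow> real" where
  "heaviside_sum P d x = (\<Sum>t\<in>P. d t * indicator {t<..} x)"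

lemma heaviside_sum_measurable [measurable]: "heaviside_sum P d \<in> borel_measurable borel"
  unfolding heaviside_sum_def by measurable

text \<open>Each of the finitely many positive distances exceeds all sufficiently small
  \<open>M\<close>. Arguing with eventuality avoids taking a minimum over a possibly empty set of
  pairs.\<close>

lemma finite_set_gap:
  fixes P :: "'a::metric_space set"
  assumes "finite P"
  obtains M where "M > 0" "\<And>x y. x \<in> P \<Longrightarrow> y \<in> P \<Longrightarrow> x \<noteq> y \<Longrightarrow> M < dist x y"
proof -
  define Q where "Q = {z \<in> P \<times> P. fst z \<noteq> snd z}"
  have "eventually (\<lambda>M. \<forall>z\<in>Q. M < dist (fst z) (snd z)) (at_right 0)"
    using assms unfolding Q_def by (intro eventually_ball_finite ballI order_tendstoD[OF tendsto_ident_at]) auto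
  then have "eventually (\<lambda>M. 0 < M \<and> (\<forall>z\<in>Q. M < dist (fst z) (snd z))) (at_right 0)"
    using eventually_at_right_less[of 0] by eventually_elim simp
  then obtain M where "0 < M" "\<forall>z\<in>Q. M < dist (fst z) (snd z)"
    using eventually_happens'[OF trivial_limit_at_right_real] by blast
  then show ?thesis
    by (intro that[of M]) (auto simp: Q_def)
qed

text \<open>Close to \<open>t\<close> each of the finitely many steps is constant. A step located at
  \<open>t\<close> itself is already switched on to the right of \<open>t\<close>, whence
  \<open>r \<le> t\<close> here against \<open>r < t\<close> on the left.\<close>

lemma heaviside_sum_eventually_right:
  assumes "finite P"
  shows "eventually (\<lambda>x. heaviside_sum P d x = (\<Sum>r\<in>P. d r * (if r \<le> t then 1 else 0))) (at_right t)"
proof -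
  have "eventually (\<lambda>x. \<forall>r\<in>P. indicator {r<..} x = (if r \<le> t then 1 else (0::real))) (at_right t)"
  proof (intro eventually_ball_finite ballI assms)
    fix r
    show "eventually (\<lambda>x. indicator {r<..} x = (if r \<le> t then 1 else (0::real))) (at_right t)"
    proof (cases "r \<le> t")
      case True
      then show ?thesis
        using eventually_at_right_less[of t] by (auto elim!: eventually_mono)
    next
      case False
      then show ?thesis
        using order_tendstoD(2)[OF tendsto_ident_at, of t r "{t<..}"] by (auto elim!: eventually_mono)
    qed
  qed
  then show ?thesis
    by eventually_elim (simp add: heaviside_sum_def)
qed

lemma heaviside_sum_eventually_left:
  assumes "finite P"
  shows "eventually (\<lambda>x. heaviside_sum P d x = (\<Sum>r\<in>P. d r * (if r < t then 1 else 0))) (at_left t)"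
proof -
  have "eventually (\<lambda>x. \<forall>r\<in>P. indicator {r<..} x = (if r < t then 1 else (0::real))) (at_left t)"
  proof (intro eventually_ball_finite ballI assms)
    fix r
    show "eventually (\<lambda>x. indicator {r<..} x = (if r < t then 1 else (0::real))) (at_left t)"
    proof (cases "r < t")
      case True
      then show ?thesis
        using order_tendstoD(1)[OF tendsto_ident_at, of r t "{..<t}"] by (auto elim!: eventually_mono)
    next
      case False
      moreover have "eventually (\<lambda>x. x < t) (at_left t)"
        by (simp add: eventually_at_filter)
      ultimately show ?thesis
        by (auto elim!: eventually_mono)
    qed
  qed
  then show ?thesis
    by eventually_elim (simp add: heaviside_sum_def)
qed

lemma eventually_inf1: "eventually P F \<Longrightarrow> eventually P (inf F G)"
  by (rule filter_leD[OF inf_le1])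

lemma eventually_inf2: "eventually P G \<Longrightarrow> eventually P (inf F G)"
  by (rule filter_leD[OF inf_le2])

context
  fixes a b k :: real and v d :: "real \<Rightarrow> real" and P :: "real set"
  assumes P: "finite P" "P \<subseteq> {a<..<b}"
    and v: "AE x in lebesgue. x \<in> {a<..<b} \<longrightarrow> v x = k + heaviside_sum P d x"
begin

lemma tendsto_ess_at_right:
  assumes "t \<in> {a<..<b}"
  shows "(v \<longlongrightarrow> k + (\<Sum>r\<in>P. d r * (if r \<le> t then 1 else 0))) (ess_at_right t)"
proof (rule tendsto_eventually)
  have ev: "eventually (\<lambda>x. x \<in> {t<..<b}) (at_right t)"
    using assms by (intro eventually_at_right_real) auto
  show "eventually (\<lambda>x. v x = k + (\<Sum>r\<in>P. d r * (if r \<le> t then 1 else 0))) (ess_at_right t)"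
    unfolding ess_at_right_def
    using eventually_inf1[OF heaviside_sum_eventually_right[OF P(1), of d t], of "ae_filter lebesgue"]
      eventually_inf2[OF v, of "at_right t"] eventually_inf1[OF ev, of "ae_filter lebesgue"]
    by eventually_elim (use assms in auto)
qed

lemma tendsto_ess_at_left:
  assumes "t \<in> {a<..<b}"
  shows "(v \<longlongrightarrow> k + (\<Sum>r\<in>P. d r * (if r < t then 1 else 0))) (ess_at_left t)"
proof (rule tendsto_eventually)
  have ev: "eventually (\<lambda>x. x \<in> {a<..<t}) (at_left t)"
    using assms by (intro eventually_at_left_real) auto
  show "eventually (\<lambda>x. v x = k + (\<Sum>r\<in>P. d r * (if r < t then 1 else 0))) (ess_at_left t)"
    unfolding ess_at_left_def
    using eventually_inf1[OF heaviside_sum_eventually_left[OF P(1), of d t], of "ae_filter lebesgue"]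
      eventually_inf2[OF v, of "at_left t"] eventually_inf1[OF ev, of "ae_filter lebesgue"]
    by eventually_elim (use assms in auto)
qed

text \<open>The conditions \<open>r \<le> t\<close> and \<open>r < t\<close> differ only for
  \<open>r = t\<close>, so a single term survives in the difference.\<close>

lemma jump_heaviside_sum:
  "(\<Sum>r\<in>P. d r * (if r \<le> t then 1 else 0)) - (\<Sum>r\<in>P. d r * (if r < t then 1 else 0)) = (if t \<in> P then d t else 0)"
proof -
  have "(\<Sum>r\<in>P. d r * (if r \<le> t then 1 else 0)) - (\<Sum>r\<in>P. d r * (if r < t then 1 else 0)) =
      (\<Sum>r\<in>P. if r = t then d r else 0)"
    unfolding sum_subtractf[symmetric] by (intro sum.cong) auto
  then show ?thesis
    using P(1) by (simp add: sum.delta)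
qed

lemma jump_eq:
  assumes "t \<in> {a<..<b}"
  shows "right_lim v t - left_lim v t = (if t \<in> P then d t else 0)"
  using tendsto_Lim[OF ess_at_right_neq_bot tendsto_ess_at_right[OF assms]]
    tendsto_Lim[OF ess_at_left_neq_bot tendsto_ess_at_left[OF assms]]
    jump_heaviside_sum[of t]
  by (simp add: right_lim_def left_lim_def)

text \<open>A partition point may separate two pieces with the same constant; such a point has
  \<open>d t = 0\<close> and is not a jump.\<close>

lemma jump_set_eq: "jump_set a b v = {t \<in> P. d t \<noteq> 0}"
proof -
  have "t \<in> jump_set a b v \<longleftrightarrow> (if t \<in> P then d t else 0) \<noteq> 0" if t: "t \<in> {a<..<b}" for t
  proof
    assume "t \<in> jump_set a b v"
    then obtain l r where "(v \<longlongrightarrow> l) (ess_at_left t)" "(v \<longlongrightarrow> r) (ess_at_right t)" "l \<noteq> r"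
      unfolding jump_set_def by blast
    then have "right_lim v t - left_lim v t \<noteq> 0"
      by (simp add: right_lim_def left_lim_def tendsto_Lim ess_at_right_neq_bot ess_at_left_neq_bot)
    then show "(if t \<in> P then d t else 0) \<noteq> 0"
      unfolding jump_eq[OF t] .
  next
    assume "(if t \<in> P then d t else 0) \<noteq> 0"
    then have "k + (\<Sum>r\<in>P. d r * (if r < t then 1 else 0)) \<noteq> k + (\<Sum>r\<in>P. d r * (if r \<le> t then 1 else 0))"
      using jump_heaviside_sum[of t] by linarith
    then show "t \<in> jump_set a b v"
      unfolding jump_set_def using t tendsto_ess_at_right[OF t] tendsto_ess_at_left[OF t] by blast
  qed
  moreover have "jump_set a b v \<subseteq> {a<..<b}"
    by (auto simp: jump_set_def)
  ultimately show ?thesis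
    using P(2) by (auto split: if_splits)
qed

text \<open>Points of \<open>P\<close> with \<open>d t = 0\<close> add nothing, so the sum may run
  over all of \<open>P\<close>.\<close>

lemma sum_jumps_sq: "(\<Sum>t\<in>jump_set a b v. \<bar>right_lim v t - left_lim v t\<bar>\<^sup>2) = (\<Sum>t\<in>P. (d t)\<^sup>2)"
proof -
  have "(\<Sum>t\<in>jump_set a b v. \<bar>right_lim v t - left_lim v t\<bar>\<^sup>2) = (\<Sum>t\<in>{t \<in> P. d t \<noteq> 0}. (d t)\<^sup>2)"
    unfolding jump_set_eq using P(2) by (intro sum.cong refl) (auto simp: jump_eq subset_eq)
  also have "\<dots> = (\<Sum>t\<in>P. (d t)\<^sup>2)"
    using P(1) by (intro sum.mono_neutral_left) auto
  finally show ?thesis .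
qed

end

text \<open>Summation by parts, after writing \<open>indicator {p (j - 1)<..<p j}\<close> almost everywhere as a difference of
  Heaviside functions.\<close>

lemma piecewise_constant_on_heaviside:
  assumes "piecewise_constant_on a b v"
  obtains P d k where "finite P" "P \<subseteq> {a<..<b}"
    "AE x in lebesgue. x \<in> {a<..<b} \<longrightarrow> v x = k + heaviside_sum P d x"
proof -
  obtain N :: nat and p :: "nat \<Rightarrow> real" and c :: "nat \<Rightarrow> real"
    where p0: "p 0 = a" and pN: "p (N + 1) = b"
      and mono: "\<forall>j\<in>{1..N+1}. p (j - 1) < p j"
      and v: "AE x in lebesgue. x \<in> {a<..<b} \<longrightarrow> v x = (\<Sum>j=1..N+1. c j * indicator {p (j - 1)<..<p j} x)"
    using assms unfolding piecewise_constant_on_def by (elim exE conjE) (rule that)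
  have less: "p i < p j" if "i < j" "j \<le> N + 1" for i j
    using that
  proof (induction j)
    case (Suc j)
    then show ?case
      using bspec[OF mono, of "Suc j"] by (cases "i = j") auto
  qed simp
  have inj: "inj_on p {1..N}"
  proof (rule inj_onI)
    fix i j assume "i \<in> {1..N}" "j \<in> {1..N}" "p i = p j"
    then show "i = j"
      using less[of i j] less[of j i] by (cases i j rule: linorder_cases) auto
  qed
  \<comment> \<open>The jump is indexed by its location, as \<open>heaviside_sum\<close> requires;
    injectivity of \<open>p\<close> on the interior indices recovers the index \<open>j\<close> from
    \<open>p j\<close>.\<close>
  define d where "d t = c (the_inv_into {1..N} p t + 1) - c (the_inv_into {1..N} p t)" for t
  have d: "d (p j) = c (j + 1) - c j" if "j \<in> {1..N}" for j
    using the_inv_into_f_f[OF inj that] by (simp add: d_def)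
  have parts: "(\<Sum>j=1..Suc n. c j * (g (j - 1) - g j)) =
      c 1 * g 0 - c (Suc n) * g (Suc n) + (\<Sum>j=1..n. (c (Suc j) - c j) * g j)" for n and g :: "nat \<Rightarrow> real"
  proof (induction n)
    case (Suc n)
    have "(\<Sum>j=1..Suc (Suc n). c j * (g (j - 1) - g j)) =
        (\<Sum>j=1..Suc n. c j * (g (j - 1) - g j)) + c (Suc (Suc n)) * (g (Suc n) - g (Suc (Suc n)))"
      by simp
    also have "\<dots> = c 1 * g 0 - c (Suc (Suc n)) * g (Suc (Suc n)) +
        ((\<Sum>j=1..n. (c (Suc j) - c j) * g j) + (c (Suc (Suc n)) - c (Suc n)) * g (Suc n))"
      unfolding Suc by (simp only: right_diff_distrib left_diff_distrib)
    also have "(\<Sum>j=1..n. (c (Suc j) - c j) * g j) + (c (Suc (Suc n)) - c (Suc n)) * g (Suc n) =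
        (\<Sum>j=1..Suc n. (c (Suc j) - c j) * g j)"
      by simp
    finally show ?case .
  qed (simp add: right_diff_distrib)
  have "AE x in lborel. x \<notin> p ` {..N+1}"
    by (rule AE_not_in) (simp add: finite_imp_null_set_lborel)
  then have "AE x in lebesgue. x \<notin> p ` {..N+1}"
    by (rule AE_completion)
  with v have "AE x in lebesgue. x \<in> {a<..<b} \<longrightarrow> v x = c 1 + heaviside_sum (p ` {1..N}) d x"
  proof eventually_elim
    case (elim x)
    show ?case
    proof
      assume x: "x \<in> {a<..<b}"
      define g where "g j = (indicator {p j<..} x :: real)" for j
      \<comment> \<open>The difference of the two Heaviside functions is the indicator of the
        interval closed on the right; the endpoint \<open>p j\<close> is covered by the exclusion of
        the partition points.\<close>
      have ind: "indicator {p (j - 1)<..<p j} x = g (j - 1) - g j" if "j \<in> {1..N+1}" for j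
        using elim(2) that bspec[OF mono that] by (auto simp: g_def indicator_def image_iff)
      \<comment> \<open>Since \<open>a < x < b\<close>, the step at \<open>a\<close> is on and the
        step at \<open>b\<close> is off: of the boundary terms only \<open>c 1\<close>
        survives.\<close>
      have g0: "g 0 = 1" and gN: "g (Suc N) = 0"
        using x p0 pN by (auto simp: g_def)
      have "v x = (\<Sum>j=1..N+1. c j * indicator {p (j - 1)<..<p j} x)"
        using elim(1) x by blast
      also have "\<dots> = (\<Sum>j=1..N+1. c j * (g (j - 1) - g j))"
        by (rule sum.cong[OF refl]) (simp only: ind)
      also have "\<dots> = c 1 + (\<Sum>j=1..N. (c (j + 1) - c j) * g j)"
        using parts[where n = N and g = g] gN by (simp only: g0 Suc_eq_plus1 mult_1_right mult_zero_right diff_zero)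
      also have "(\<Sum>j=1..N. (c (j + 1) - c j) * g j) = heaviside_sum (p ` {1..N}) d x"
        unfolding heaviside_sum_def sum.reindex[OF inj] o_def
        by (rule sum.cong[OF refl]) (simp only: d g_def)
      finally show "v x = c 1 + heaviside_sum (p ` {1..N}) d x" .
    qed
  qed
  moreover have "p ` {1..N} \<subseteq> {a<..<b}"
    using less[of 0] less[of _ "N + 1"] p0 pN by auto
  ultimately show ?thesis
    by (intro that[of "p ` {1..N}"]) auto
qed

subsection \<open>Increments of piecewise constant functions\<close>

text \<open>Translating by \<open>h\<close> exchanges the two end points of the increment, and both
  the square and the product of the indicators are symmetric in them.\<close>

lemma increment_sq_uminus:
  assumes [measurable]: "w \<in> borel_measurable borel"
  shows "increment_sq a b w (- h) = increment_sq a b w h"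
proof -
  have "increment_sq a b w (- h) = (\<integral>\<^sup>+ x. ennreal ((w (h + x - h) - w (h + x))\<^sup>2) *
      indicator {a<..<b} (h + x - h) * indicator {a<..<b} (h + x) \<partial>lborel)"
    unfolding increment_sq_def by (subst nn_integral_real_affine[where c = 1 and t = h]) auto
  also have "\<dots> = increment_sq a b w h"
    unfolding increment_sq_def
    by (intro nn_integral_cong) (simp add: power2_commute add.commute mult_ac)
  finally show ?thesis .
qed

text \<open>At most one term is nonzero, so squaring produces no cross terms.\<close>

lemma sum_indicator_disjoint_sq:
  fixes d e :: "'a \<Rightarrow> real"
  assumes "finite P" and e01: "\<And>t. t \<in> P \<Longrightarrow> e t = 0 \<or> e t = 1"
    and disj: "\<And>t t'. t \<in> P \<Longrightarrow> t' \<in> P \<Longrightarrow> e t = 1 \<Longrightarrow> e t' = 1 \<Longrightarrow> t = t'"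
  shows "(\<Sum>t\<in>P. d t * e t)\<^sup>2 = (\<Sum>t\<in>P. (d t)\<^sup>2 * e t)"
proof (cases "\<exists>t\<in>P. e t = 1")
  case True
  then obtain r where r: "r \<in> P" "e r = 1" by blast
  have e: "e t = (if t = r then 1 else 0)" if "t \<in> P" for t
    using e01 disj r that by metis
  have "(\<Sum>t\<in>P. d t * e t) = (\<Sum>t\<in>P. if t = r then d t else 0)"
    "(\<Sum>t\<in>P. (d t)\<^sup>2 * e t) = (\<Sum>t\<in>P. if t = r then (d t)\<^sup>2 else 0)"
    by (rule sum.cong; simp add: e)+
  then show ?thesis
    using r(1) assms(1) by simp
next
  case False
  then have "e t = 0" if "t \<in> P" for t
    using e01 that by blast
  then show ?thesis
    by simp
qed

text \<open>The jump at \<open>t\<close> is crossed exactly for \<open>x\<close> in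
  \<open>{t - h<..t}\<close>, a set of length \<open>h\<close>. These sets are disjoint because
  \<open>h\<close> is smaller than the gaps, and \<open>end_gap\<close> keeps \<open>x\<close> and
  \<open>x + h\<close> inside the interval there, so nothing is cut off at the ends.\<close>

lemma increment_sq_heaviside_pos:
  assumes P: "finite P" and gap: "\<And>t t'. t \<in> P \<Longrightarrow> t' \<in> P \<Longrightarrow> t \<noteq> t' \<Longrightarrow> M < dist t t'"
    and end_gap: "\<And>t. t \<in> P \<Longrightarrow> a + M < t \<and> t + M < b"
    and h: "0 \<le> h" "h \<le> M"
  shows "increment_sq a b (\<lambda>x. k + heaviside_sum P d x) h = ennreal (h * (\<Sum>t\<in>P. (d t)\<^sup>2))"
proof -
  have incr: "heaviside_sum P d (x + h) - heaviside_sum P d x = (\<Sum>t\<in>P. d t * indicator {t - h<..t} x)" for x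
    unfolding heaviside_sum_def sum_subtractf[symmetric]
    using h(1) by (intro sum.cong refl) (auto simp: indicator_def)
  have sq: "(heaviside_sum P d (x + h) - heaviside_sum P d x)\<^sup>2 = (\<Sum>t\<in>P. (d t)\<^sup>2 * indicator {t - h<..t} x)" for x
    unfolding incr
  proof (rule sum_indicator_disjoint_sq[OF P])
    fix t t' assume "t \<in> P" "t' \<in> P" "indicator {t - h<..t} x = (1::real)" "indicator {t' - h<..t'} x = (1::real)"
    then show "t = t'"
      using gap[of t t'] h by (cases "t = t'") (auto simp: indicator_def dist_real_def split: if_splits)
  qed (auto simp: indicator_def)
  have "increment_sq a b (\<lambda>x. k + heaviside_sum P d x) h =
      (\<integral>\<^sup>+ x. (\<Sum>t\<in>P. ennreal ((d t)\<^sup>2) * indicator {t - h<..t} x) \<partial>lborel)"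
    unfolding increment_sq_def
  proof (intro nn_integral_cong)
    fix x :: real
    have "ennreal ((k + heaviside_sum P d (x + h) - (k + heaviside_sum P d x))\<^sup>2) *
        indicator {a<..<b} (x + h) * indicator {a<..<b} x =
        (\<Sum>t\<in>P. ennreal ((d t)\<^sup>2 * indicator {t - h<..t} x) * (indicator {a<..<b} (x + h) * indicator {a<..<b} x))"
      by (simp add: sq sum_distrib_right mult.assoc flip: sum_ennreal)
    also have "\<dots> = (\<Sum>t\<in>P. ennreal ((d t)\<^sup>2) * indicator {t - h<..t} x)"
    proof (rule sum.cong[OF refl])
      fix t assume "t \<in> P"
      then show "ennreal ((d t)\<^sup>2 * indicator {t - h<..t} x) * (indicator {a<..<b} (x + h) * indicator {a<..<b} x) =
          ennreal ((d t)\<^sup>2) * indicator {t - h<..t} x"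
        using end_gap[of t] h by (cases "x \<in> {t - h<..t}") auto
    qed
    finally show "ennreal ((k + heaviside_sum P d (x + h) - (k + heaviside_sum P d x))\<^sup>2) *
        indicator {a<..<b} (x + h) * indicator {a<..<b} x = \<dots>" .
  qed
  also have "\<dots> = (\<Sum>t\<in>P. ennreal ((d t)\<^sup>2) * ennreal h)"
    using h(1) by (subst nn_integral_sum) (auto simp: nn_integral_cmult_indicator)
  also have "\<dots> = ennreal (h * (\<Sum>t\<in>P. (d t)\<^sup>2))"
    using h(1) by (simp add: ennreal_mult[symmetric] sum_ennreal sum_distrib_left mult.commute)
  finally show ?thesis .
qed

lemma increment_sq_heaviside:
  assumes P: "finite P" and gap: "\<And>t t'. t \<in> P \<Longrightarrow> t' \<in> P \<Longrightarrow> t \<noteq> t' \<Longrightarrow> M < dist t t'"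
    and end_gap: "\<And>t. t \<in> P \<Longrightarrow> a + M < t \<and> t + M < b"
    and h: "\<bar>h\<bar> \<le> M"
  shows "increment_sq a b (\<lambda>x. k + heaviside_sum P d x) h = ennreal (\<bar>h\<bar> * (\<Sum>t\<in>P. (d t)\<^sup>2))"
proof (cases "h \<ge> 0")
  case True
  then show ?thesis
    using increment_sq_heaviside_pos[OF P gap end_gap, of h] h by auto
next
  case False
  then have "increment_sq a b (\<lambda>x. k + heaviside_sum P d x) (- h) = ennreal (- h * (\<Sum>t\<in>P. (d t)\<^sup>2))"
    using increment_sq_heaviside_pos[OF P gap end_gap, of "- h"] h by auto
  then show ?thesis
    using False by (simp add: increment_sq_uminus)
qed

text \<open>Two points of the interval differ by at most \<open>b - a\<close>, which bounds the
  support in \<open>h\<close>. This crude estimate serves for the increments larger than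
  \<open>M\<close>.\<close>

lemma increment_sq_le:
  assumes "a \<le> b" "\<And>x y. (w x - w y)\<^sup>2 \<le> C"
  shows "increment_sq a b w h \<le> ennreal (C * (b - a)) * indicator {a - b..b - a} h"
proof -
  have "0 \<le> C"
    using order_trans[OF zero_le_power2 assms(2)] .
  have "increment_sq a b w h \<le> (\<integral>\<^sup>+ x. (ennreal C * indicator {a - b..b - a} h) * indicator {a<..<b} x \<partial>lborel)"
    unfolding increment_sq_def
    by (intro nn_integral_mono) (auto simp: indicator_def intro!: ennreal_leI assms(2))
  also have "\<dots> = ennreal (C * (b - a)) * indicator {a - b..b - a} h"
    using assms(1) \<open>0 \<le> C\<close> by (subst nn_integral_cmult_indicator) (auto simp: ennreal_mult mult_ac)
  finally show ?thesis .
qed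

lemma heaviside_sum_diff_sq_le: "(heaviside_sum P d x - heaviside_sum P d y)\<^sup>2 \<le> (\<Sum>t\<in>P. \<bar>d t\<bar>)\<^sup>2"
proof -
  have "\<bar>heaviside_sum P d x - heaviside_sum P d y\<bar> \<le> (\<Sum>t\<in>P. \<bar>d t * indicator {t<..} x - d t * indicator {t<..} y\<bar>)"
    unfolding heaviside_sum_def sum_subtractf[symmetric] by (rule sum_abs)
  also have "\<dots> \<le> (\<Sum>t\<in>P. \<bar>d t\<bar>)"
    by (intro sum_mono) (auto simp: indicator_def)
  finally have "\<bar>heaviside_sum P d x - heaviside_sum P d y\<bar>\<^sup>2 \<le> (\<Sum>t\<in>P. \<bar>d t\<bar>)\<^sup>2"
    by (intro power_mono) auto
  then show ?thesis by simp
qed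

text \<open>Away from \<open>h = 0\<close> the kernel is at most
  \<open>M powr (- (2 + 2 * s))\<close>. As \<open>M \<le> 1\<close> and
  \<open>s \<le> 1 / 2\<close>, this is at most \<open>1 / M ^ 3\<close> uniformly in
  \<open>s\<close>; the factor \<open>\<epsilon>\<^sup>2\<close> is the area of the vertical
  square.\<close>

lemma film_kernel_le:
  assumes "0 < M" "M \<le> 1" "M \<le> \<bar>h\<bar>" "0 \<le> \<epsilon>" "0 \<le> s" "s \<le> 1 / 2"
  shows "film_kernel s \<epsilon> h \<le> ennreal (\<epsilon>\<^sup>2 / M ^ 3)"
proof -
  have k: "(h\<^sup>2 + z\<^sup>2) powr (- (1 + s)) \<le> 1 / M ^ 3" for z
  proof -
    have "(h\<^sup>2 + z\<^sup>2) powr (- (1 + s)) \<le> (M\<^sup>2) powr (- (1 + s))"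
    proof (rule powr_mono2')
      show "M\<^sup>2 \<le> h\<^sup>2 + z\<^sup>2"
        using assms power_mono[of M "\<bar>h\<bar>" 2] by (simp add: add_increasing2)
    qed (use assms in auto)
    also have "\<dots> = M powr (- (2 + 2 * s))"
      using power2_powr_uminus[OF assms(1), of "1 + s"] by (simp add: algebra_simps)
    also have "\<dots> \<le> M powr (- 3)"
      using assms by (intro powr_mono') auto
    also have "\<dots> = 1 / M ^ 3"
      using assms by (simp add: powr_minus_divide)
    finally show ?thesis .
  qed
  have "film_kernel s \<epsilon> h \<le> (\<integral>\<^sup>+ y. (\<integral>\<^sup>+ x. ennreal (1 / M ^ 3) * indicator {0<..<\<epsilon>} x \<partial>lborel) * indicator {0<..<\<epsilon>} y \<partial>lborel)"
    unfolding film_kernel_def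
    by (intro nn_integral_mono mult_right_mono ennreal_leI k) auto
  also have "\<dots> = ennreal (1 / M ^ 3) * ennreal \<epsilon> * ennreal \<epsilon>"
    using assms by (simp add: nn_integral_cmult_indicator)
  also have "\<dots> = ennreal (\<epsilon>\<^sup>2 / M ^ 3)"
    using assms by (simp add: ennreal_mult[symmetric] power2_eq_square)
  finally show ?thesis .
qed

subsection \<open>Integrals of the kernel\<close>

text \<open>The weight \<open>\<bar>h\<bar>\<close> produced by the jumps is what makes the kernel
  explicitly integrable: \<open>h\<close> times the kernel is the derivative of a power of
  \<open>h\<^sup>2 + z\<^sup>2\<close>, which stays positive since
  \<open>z \<noteq> 0\<close>.\<close>

lemma nn_integral_radial:
  fixes s M z :: real
  assumes "0 < s" "0 \<le> M" "z \<noteq> 0"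
  shows "(\<integral>\<^sup>+ h. ennreal (\<bar>h\<bar> * (h\<^sup>2 + z\<^sup>2) powr (- (1 + s))) * indicator {- M..M} h \<partial>lborel) =
    ennreal ((\<bar>z\<bar> powr (- 2 * s) - (M\<^sup>2 + z\<^sup>2) powr (- s)) / s)"
proof -
  let ?k = "\<lambda>h. (h\<^sup>2 + z\<^sup>2) powr (- (1 + s))"
  define F where "F h = - ((h\<^sup>2 + z\<^sup>2) powr (- s)) / (2 * s)" for h
  have pos: "h\<^sup>2 + z\<^sup>2 > 0" for h
    using assms(3) by (simp add: add_nonneg_pos)
  have F: "(F has_real_derivative h * ?k h) (at h)" for h
  proof -
    have "((\<lambda>h. h\<^sup>2 + z\<^sup>2) has_real_derivative 2 * h) (at h)"
      by (auto intro!: derivative_eq_intros)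
    note der = DERIV_fun_powr[OF this pos[of h], of "- s"]
    have "- s - of_nat 1 = - (1 + s)"
      by simp
    then have "((\<lambda>h. (h\<^sup>2 + z\<^sup>2) powr (- s)) has_real_derivative - s * ?k h * (2 * h)) (at h)"
      using der by (simp only:)
    from DERIV_cdivide[OF DERIV_minus[OF this], of "2 * s"]
    show ?thesis
      unfolding F_def using assms(1) by (simp add: field_simps)
  qed
  have F0: "F 0 = - (\<bar>z\<bar> powr (- 2 * s)) / (2 * s)"
    using power2_powr_uminus[of "\<bar>z\<bar>" s] assms(3) by (simp add: F_def)
  have mono: "F 0 \<le> F M"
    using F assms(2) by (intro DERIV_nonneg_imp_nondecreasing[of 0 M F]) (auto intro!: exI)
  have right: "(\<integral>\<^sup>+ h. ennreal (h * ?k h) * indicator {0..M} h \<partial>lborel) = ennreal (F M - F 0)"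
    using assms(2) by (intro nn_integral_FTC_Icc F) auto
  \<comment> \<open>On the negative half \<open>- F\<close> is the antiderivative; since
    \<open>F\<close> is even, both halves contribute the same amount.\<close>
  have left: "(\<integral>\<^sup>+ h. ennreal (- h * ?k h) * indicator {- M..0} h \<partial>lborel) = ennreal (- F 0 - - F (- M))"
    using assms(2) DERIV_minus[OF F]
    by (intro nn_integral_FTC_Icc) (auto intro!: mult_nonpos_nonneg)
  have "(\<integral>\<^sup>+ h. ennreal (\<bar>h\<bar> * ?k h) * indicator {- M..M} h \<partial>lborel) =
      (\<integral>\<^sup>+ h. ennreal (- h * ?k h) * indicator {- M..0} h + ennreal (h * ?k h) * indicator {0..M} h \<partial>lborel)"
    using assms(2) by (intro nn_integral_cong) (auto simp: indicator_def)
  also have "\<dots> = ennreal (- F 0 - - F (- M)) + ennreal (F M - F 0)"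
    unfolding left[symmetric] right[symmetric] by (rule nn_integral_add) measurable
  also have "\<dots> = ennreal (2 * (F M - F 0))"
    using mono by (simp add: F_def flip: ennreal_plus)
  also have "2 * (F M - F 0) = (\<bar>z\<bar> powr (- 2 * s) - (M\<^sup>2 + z\<^sup>2) powr (- s)) / s"
    unfolding F0 unfolding F_def using assms(1) by (simp add: field_simps)
  finally show ?thesis .
qed

section \<open>Power integrals over an interval and over its square\<close>

lemma nn_integral_powr_Icc:
  fixes p c :: real
  assumes "p > - 1" "c \<ge> 0"
  shows "(\<integral>\<^sup>+ x. ennreal (x powr p) * indicator {0..c} x \<partial>lborel) = ennreal (c powr (p + 1) / (p + 1))"
  using assms by (intro nn_integral_has_integral_lebesgue' has_integral_powr_from_0) auto

lemma nn_integral_powr_reflect: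
  fixes p c :: real
  assumes "p > - 1" "c \<ge> 0"
  shows "(\<integral>\<^sup>+ x. ennreal ((c - x) powr p) * indicator {0..c} x \<partial>lborel) = ennreal (c powr (p + 1) / (p + 1))"
proof -
  have "(\<integral>\<^sup>+ x. ennreal ((c - x) powr p) * indicator {0..c} x \<partial>lborel) =
      (\<integral>\<^sup>+ x. ennreal ((c - (c + - 1 * x)) powr p) * indicator {0..c} (c + - 1 * x) \<partial>lborel)"
    by (subst nn_integral_real_affine[where c = "- 1" and t = c]) auto
  also have "\<dots> = (\<integral>\<^sup>+ x. ennreal (x powr p) * indicator {0..c} x \<partial>lborel)"
    by (intro nn_integral_cong) (auto simp: indicator_def)
  finally show ?thesis
    using nn_integral_powr_Icc[OF assms] by simp
qed

lemma nn_integral_powr_shift: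
  fixes p c y :: real
  assumes "p > - 1" "y \<le> c"
  shows "(\<integral>\<^sup>+ x. ennreal ((x - y) powr p) * indicator {y..c} x \<partial>lborel) = ennreal ((c - y) powr (p + 1) / (p + 1))"
proof -
  have "(\<integral>\<^sup>+ x. ennreal ((x - y) powr p) * indicator {y..c} x \<partial>lborel) =
      (\<integral>\<^sup>+ x. ennreal ((y + 1 * x - y) powr p) * indicator {y..c} (y + 1 * x) \<partial>lborel)"
    by (subst nn_integral_real_affine[where c = 1 and t = y]) auto
  also have "\<dots> = (\<integral>\<^sup>+ x. ennreal (x powr p) * indicator {0..c - y} x \<partial>lborel)"
    by (intro nn_integral_cong) (auto simp: indicator_def)
  finally show ?thesis
    using nn_integral_powr_Icc[of p "c - y"] assms by simp
qed

lemma nn_integral_abs_diff_powr: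
  fixes p c y :: real
  assumes "p > - 1" "0 < y" "y < c"
  shows "(\<integral>\<^sup>+ x. ennreal (\<bar>x - y\<bar> powr p) * indicator {0<..<c} x \<partial>lborel) =
    ennreal ((y powr (p + 1) + (c - y) powr (p + 1)) / (p + 1))"
proof -
  have "(\<integral>\<^sup>+ x. ennreal (\<bar>x - y\<bar> powr p) * indicator {0<..<c} x \<partial>lborel) =
      (\<integral>\<^sup>+ x. ennreal ((y - x) powr p) * indicator {0..y} x + ennreal ((x - y) powr p) * indicator {y..c} x \<partial>lborel)"
  \<comment> \<open>The two closed pieces overlap at \<open>x = y\<close>, where all terms vanish by
    \<open>0 powr p = 0\<close>; the end points 0 and \<open>c\<close> are discarded as null
    sets.\<close>
  proof (rule nn_integral_cong_AE, use AE_lborel_singleton[of 0] AE_lborel_singleton[of c] in eventually_elim)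
    case (elim x)
    then show ?case
      using assms by (cases x y rule: linorder_cases) (auto simp: indicator_def abs_if)
  qed
  also have "\<dots> = ennreal (y powr (p + 1) / (p + 1)) + ennreal ((c - y) powr (p + 1) / (p + 1))"
    using assms by (subst nn_integral_add) (auto simp: nn_integral_powr_reflect nn_integral_powr_shift)
  also have "\<dots> = ennreal ((y powr (p + 1) + (c - y) powr (p + 1)) / (p + 1))"
    using assms by (simp add: add_divide_distrib flip: ennreal_plus)
  finally show ?thesis .
qed

text \<open>Two successive integrations of powers, with \<open>q = 1 - 2 * s\<close>, give
  \<open>2 * \<epsilon> powr (q + 1) / (q * (q + 1))\<close>, and
  \<open>q + 1 = 2 * (1 - s)\<close>. The bound \<open>s < 1 / 2\<close> makes the diagonal
  singularity integrable.\<close>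

lemma nn_integral_nn_integral_abs_diff_powr:
  fixes s \<epsilon> :: real
  assumes "0 < s" "s < 1 / 2" "0 < \<epsilon>"
  shows "(\<integral>\<^sup>+ y. (\<integral>\<^sup>+ x. ennreal (\<bar>x - y\<bar> powr (- 2 * s)) * indicator {0<..<\<epsilon>} x \<partial>lborel) * indicator {0<..<\<epsilon>} y \<partial>lborel) =
    ennreal (\<epsilon> powr (2 - 2 * s) / ((1 - 2 * s) * (1 - s)))"
proof -
  let ?q = "1 - 2 * s"
  have inner: "(\<integral>\<^sup>+ x. ennreal (\<bar>x - y\<bar> powr (- 2 * s)) * indicator {0<..<\<epsilon>} x \<partial>lborel) =
      ennreal (1 / ?q * (y powr ?q + (\<epsilon> - y) powr ?q))" if "y \<in> {0<..<\<epsilon>}" for y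
  proof -
    have "(\<integral>\<^sup>+ x. ennreal (\<bar>x - y\<bar> powr (- 2 * s)) * indicator {0<..<\<epsilon>} x \<partial>lborel) =
        ennreal ((y powr (- 2 * s + 1) + (\<epsilon> - y) powr (- 2 * s + 1)) / (- 2 * s + 1))"
      using that assms by (intro nn_integral_abs_diff_powr) auto
    also have "- 2 * s + 1 = ?q"
      by simp
    finally show ?thesis
      by simp
  qed
  have "(\<integral>\<^sup>+ y. (\<integral>\<^sup>+ x. ennreal (\<bar>x - y\<bar> powr (- 2 * s)) * indicator {0<..<\<epsilon>} x \<partial>lborel) * indicator {0<..<\<epsilon>} y \<partial>lborel) =
      (\<integral>\<^sup>+ y. ennreal (1 / ?q) * (ennreal (y powr ?q) * indicator {0..\<epsilon>} y + ennreal ((\<epsilon> - y) powr ?q) * indicator {0..\<epsilon>} y) \<partial>lborel)"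
  proof (rule nn_integral_cong_AE, use AE_lborel_singleton[of 0] AE_lborel_singleton[of \<epsilon>] in eventually_elim)
    case (elim y)
    show ?case
    proof (cases "y \<in> {0<..<\<epsilon>}")
      case True
      then show ?thesis
        unfolding inner[OF True] using assms by (simp flip: ennreal_mult ennreal_plus)
    next
      case False
      then show ?thesis
        using elim by (auto simp: indicator_def)
    qed
  qed
  also have "\<dots> = ennreal (1 / ?q) * (ennreal (\<epsilon> powr (?q + 1) / (?q + 1)) + ennreal (\<epsilon> powr (?q + 1) / (?q + 1)))"
    using assms nn_integral_powr_Icc[of ?q \<epsilon>] nn_integral_powr_reflect[of ?q \<epsilon>]
    by (subst nn_integral_cmult, measurable, subst nn_integral_add) auto
  also have "\<dots> = ennreal (1 / ?q * (2 * (\<epsilon> powr (?q + 1) / (?q + 1))))"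
    using assms by (simp add: ennreal_mult[symmetric] ennreal_plus[symmetric] del: ennreal_plus)
  also have "1 / ?q * (2 * (\<epsilon> powr (?q + 1) / (?q + 1))) = \<epsilon> powr (2 - 2 * s) / ((1 - 2 * s) * (1 - s))"
  proof -
    have q: "?q + 1 = 2 - 2 * s"
      by simp
    have "2 * (e / (2 - 2 * s)) = e / (1 - s)" for e
      using assms by (simp add: field_simps)
    then show ?thesis
      unfolding q by simp
  qed
  finally show ?thesis .
qed

text \<open>Cancellation is legitimate because the finite total forces \<open>x\<close> to be
  finite.\<close>

lemma ennreal_add_eq_imp:
  assumes "x + ennreal c = ennreal d" "0 \<le> c" "0 \<le> d"
  shows "x = ennreal (d - c)"
proof (cases x)
  case (real r)
  then show ?thesis
    using assms by (simp flip: ennreal_plus)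
next
  case top
  with assms(1) show ?thesis
    by simp
qed

text \<open>A Riesz-type double integral with a constant taken off the kernel; \<open>B\<close>
  stands in for the \<open>M\<close>-dependent term of the radial integral. A negative difference
  would be clipped to 0 by \<open>ennreal\<close>.\<close>

definition truncated_riesz :: "real \<Rightarrow> real \<Rightarrow> real \<Rightarrow> ennreal" where
  "truncated_riesz s B \<epsilon> = (\<integral>\<^sup>+ y. (\<integral>\<^sup>+ x. ennreal (\<bar>x - y\<bar> powr (- 2 * s) - B) *
      indicator {0<..<\<epsilon>} x \<partial>lborel) * indicator {0<..<\<epsilon>} y \<partial>lborel)"

text \<open>Distances within the interval are below \<open>\<epsilon>\<close>, so off the diagonal
  the power is at least \<open>\<epsilon> powr (- 2 * s)\<close>, hence at least \<open>B\<close>,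
  and no clipping occurs. The constant then integrates to the finite amount
  \<open>B * \<epsilon>\<^sup>2\<close>, which can be cancelled.\<close>

lemma truncated_riesz_eq:
  assumes s: "0 < s" "s < 1 / 2" and \<epsilon>: "0 < \<epsilon>" and B: "0 \<le> B" "B \<le> \<epsilon> powr (- 2 * s)"
  shows "truncated_riesz s B \<epsilon> = ennreal (\<epsilon> powr (2 - 2 * s) / ((1 - 2 * s) * (1 - s)) - B * \<epsilon>\<^sup>2)"
proof -
  let ?J = "indicator {0<..<\<epsilon>} :: real \<Rightarrow> ennreal"
  let ?R = "\<lambda>y. \<integral>\<^sup>+ x. ennreal (\<bar>x - y\<bar> powr (- 2 * s) - B) * ?J x \<partial>lborel"
  have inner: "(\<integral>\<^sup>+ x. ennreal (\<bar>x - y\<bar> powr (- 2 * s)) * ?J x \<partial>lborel) * ?J y = ?R y * ?J y + ennreal (B * \<epsilon>) * ?J y" for y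
  proof (cases "y \<in> {0<..<\<epsilon>}")
    case True
    have "(\<integral>\<^sup>+ x. ennreal (\<bar>x - y\<bar> powr (- 2 * s)) * ?J x \<partial>lborel) =
        (\<integral>\<^sup>+ x. ennreal (\<bar>x - y\<bar> powr (- 2 * s) - B) * ?J x + ennreal B * ?J x \<partial>lborel)"
    \<comment> \<open>The diagonal must be left out: there \<open>0 powr (- 2 * s)\<close> is 0
      instead of infinite, and the comparison with \<open>\<epsilon> powr (- 2 * s)\<close>
      fails.\<close>
    proof (rule nn_integral_cong_AE, use AE_lborel_singleton[of y] in eventually_elim)
      case (elim x)
      show ?case
      proof (cases "x \<in> {0<..<\<epsilon>}")
        case x: True
        have "\<epsilon> powr (- 2 * s) \<le> \<bar>x - y\<bar> powr (- 2 * s)"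
          using x True elim s by (intro powr_mono2') auto
        then show ?thesis
          using x B by (simp flip: ennreal_plus)
      qed simp
    qed
    also have "\<dots> = ?R y + ennreal B * ennreal \<epsilon>"
      using \<epsilon> by (subst nn_integral_add) (auto simp: nn_integral_cmult_indicator)
    finally show ?thesis
      using B \<epsilon> True by (simp add: ennreal_mult)
  qed simp
  have "ennreal (\<epsilon> powr (2 - 2 * s) / ((1 - 2 * s) * (1 - s))) = truncated_riesz s B \<epsilon> + ennreal (B * \<epsilon>) * ennreal \<epsilon>"
    unfolding truncated_riesz_def nn_integral_nn_integral_abs_diff_powr[OF s \<epsilon>, symmetric] inner
    using \<epsilon> by (subst nn_integral_add) (auto simp: nn_integral_cmult_indicator)
  also have "ennreal (B * \<epsilon>) * ennreal \<epsilon> = ennreal (B * \<epsilon>\<^sup>2)"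
    using B \<epsilon> by (simp add: ennreal_mult[symmetric] power2_eq_square mult.assoc)
  finally show ?thesis
    using s B by (intro ennreal_add_eq_imp) auto
qed

text \<open>Tonelli moves the \<open>h\<close>-integral to the innermost place, where the radial
  formula evaluates it for every \<open>x\<close> different from \<open>y\<close>.\<close>

lemma nn_integral_abs_film_kernel:
  assumes "0 < s" "0 \<le> M"
  shows "(\<integral>\<^sup>+ h. ennreal \<bar>h\<bar> * indicator {- M..M} h * film_kernel s \<epsilon> h \<partial>lborel) =
    (\<integral>\<^sup>+ y. (\<integral>\<^sup>+ x. ennreal ((\<bar>x - y\<bar> powr (- 2 * s) - (M\<^sup>2 + (x - y)\<^sup>2) powr (- s)) / s) *
      indicator {0<..<\<epsilon>} x \<partial>lborel) * indicator {0<..<\<epsilon>} y \<partial>lborel)"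
proof -
  let ?J = "indicator {0<..<\<epsilon>} :: real \<Rightarrow> ennreal"
  let ?a = "\<lambda>h. ennreal \<bar>h\<bar> * indicator {- M..M} h"
  let ?k = "\<lambda>h z. ennreal ((h\<^sup>2 + z\<^sup>2) powr (- (1 + s)))"
  have "(\<integral>\<^sup>+ h. ?a h * film_kernel s \<epsilon> h \<partial>lborel) =
      (\<integral>\<^sup>+ h. (\<integral>\<^sup>+ y. ?a h * ((\<integral>\<^sup>+ x. ?k h (x - y) * ?J x \<partial>lborel) * ?J y) \<partial>lborel) \<partial>lborel)"
    unfolding film_kernel_def by (intro nn_integral_cong nn_integral_cmult[symmetric]) measurable
  also have "\<dots> = (\<integral>\<^sup>+ y. (\<integral>\<^sup>+ h. ?a h * ((\<integral>\<^sup>+ x. ?k h (x - y) * ?J x \<partial>lborel) * ?J y) \<partial>lborel) \<partial>lborel)"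
    by (rule lborel_pair.Fubini'[where f = "\<lambda>y h. ?a h * ((\<integral>\<^sup>+ x. ?k h (x - y) * ?J x \<partial>lborel) * ?J y)"]) measurable
  also have "\<dots> = (\<integral>\<^sup>+ y. (\<integral>\<^sup>+ h. (\<integral>\<^sup>+ x. ?a h * ?k h (x - y) * ?J x \<partial>lborel) \<partial>lborel) * ?J y \<partial>lborel)"
  proof (rule nn_integral_cong)
    fix y :: real
    have "(\<integral>\<^sup>+ x. ?a h * ?k h (x - y) * ?J x \<partial>lborel) = ?a h * (\<integral>\<^sup>+ x. ?k h (x - y) * ?J x \<partial>lborel)" for h
      unfolding mult.assoc by (subst nn_integral_cmult; measurable)+
    then show "(\<integral>\<^sup>+ h. ?a h * ((\<integral>\<^sup>+ x. ?k h (x - y) * ?J x \<partial>lborel) * ?J y) \<partial>lborel) =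
        (\<integral>\<^sup>+ h. (\<integral>\<^sup>+ x. ?a h * ?k h (x - y) * ?J x \<partial>lborel) \<partial>lborel) * ?J y"
      by (subst nn_integral_multc[symmetric]) (auto simp: mult.assoc)
  qed
  also have "\<dots> = (\<integral>\<^sup>+ y. (\<integral>\<^sup>+ x. (\<integral>\<^sup>+ h. ?a h * ?k h (x - y) * ?J x \<partial>lborel) \<partial>lborel) * ?J y \<partial>lborel)"
  proof (rule nn_integral_cong)
    fix y :: real
    have "(\<integral>\<^sup>+ h. (\<integral>\<^sup>+ x. ?a h * ?k h (x - y) * ?J x \<partial>lborel) \<partial>lborel) =
        (\<integral>\<^sup>+ x. (\<integral>\<^sup>+ h. ?a h * ?k h (x - y) * ?J x \<partial>lborel) \<partial>lborel)"
      by (rule lborel_pair.Fubini'[where f = "\<lambda>x h. ?a h * ?k h (x - y) * ?J x"]) measurable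
    then show "(\<integral>\<^sup>+ h. (\<integral>\<^sup>+ x. ?a h * ?k h (x - y) * ?J x \<partial>lborel) \<partial>lborel) * ?J y =
        (\<integral>\<^sup>+ x. (\<integral>\<^sup>+ h. ?a h * ?k h (x - y) * ?J x \<partial>lborel) \<partial>lborel) * ?J y"
      by simp
  qed
  also have "\<dots> = (\<integral>\<^sup>+ y. (\<integral>\<^sup>+ x. ennreal ((\<bar>x - y\<bar> powr (- 2 * s) - (M\<^sup>2 + (x - y)\<^sup>2) powr (- s)) / s) * ?J x \<partial>lborel) * ?J y \<partial>lborel)"
  proof (rule nn_integral_cong)
    fix y :: real
    have "(\<integral>\<^sup>+ x. (\<integral>\<^sup>+ h. ?a h * ?k h (x - y) * ?J x \<partial>lborel) \<partial>lborel) =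
        (\<integral>\<^sup>+ x. ennreal ((\<bar>x - y\<bar> powr (- 2 * s) - (M\<^sup>2 + (x - y)\<^sup>2) powr (- s)) / s) * ?J x \<partial>lborel)"
    proof (rule nn_integral_cong_AE, use AE_lborel_singleton[of y] in eventually_elim)
      case (elim x)
      have "(\<integral>\<^sup>+ h. ?a h * ?k h (x - y) * ?J x \<partial>lborel) =
          (\<integral>\<^sup>+ h. ennreal (\<bar>h\<bar> * (h\<^sup>2 + (x - y)\<^sup>2) powr (- (1 + s))) * indicator {- M..M} h \<partial>lborel) * ?J x"
        by (subst nn_integral_multc[symmetric]) (auto simp: ennreal_mult mult_ac)
      also have "\<dots> = ennreal ((\<bar>x - y\<bar> powr (- 2 * s) - (M\<^sup>2 + (x - y)\<^sup>2) powr (- s)) / s) * ?J x"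
        using assms elim by (subst nn_integral_radial) auto
      finally show ?case .
    qed
    then show "(\<integral>\<^sup>+ x. (\<integral>\<^sup>+ h. ?a h * ?k h (x - y) * ?J x \<partial>lborel) \<partial>lborel) * ?J y =
        (\<integral>\<^sup>+ x. ennreal ((\<bar>x - y\<bar> powr (- 2 * s) - (M\<^sup>2 + (x - y)\<^sup>2) powr (- s)) / s) * ?J x \<partial>lborel) * ?J y"
      by simp
  qed
  finally show ?thesis .
qed

lemma truncated_riesz_cmult:
  assumes "0 < s"
  shows "ennreal (1 / s) * truncated_riesz s B \<epsilon> =
    (\<integral>\<^sup>+ y. (\<integral>\<^sup>+ x. ennreal ((\<bar>x - y\<bar> powr (- 2 * s) - B) / s) *
      indicator {0<..<\<epsilon>} x \<partial>lborel) * indicator {0<..<\<epsilon>} y \<partial>lborel)"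
proof -
  have "ennreal ((\<bar>x - y\<bar> powr (- 2 * s) - B) / s) = ennreal (1 / s) * ennreal (\<bar>x - y\<bar> powr (- 2 * s) - B)" for x y
    using assms by (simp flip: ennreal_mult')
  then show ?thesis
    unfolding truncated_riesz_def
    by (simp add: mult.assoc nn_integral_cmult)
qed

text \<open>For \<open>z = x - y\<close> with \<open>\<bar>z\<bar> \<le> M\<close> the quantity
  \<open>M\<^sup>2 + z\<^sup>2\<close> lies between \<open>M\<^sup>2\<close> and
  \<open>2 * M\<^sup>2\<close>. The exponent \<open>- s\<close> reverses the order and the
  subtraction restores it, so the smaller base gives the lower bound.\<close>

lemma nn_integral_abs_film_kernel_bounds:
  assumes "0 < s" "0 < M" "\<epsilon> \<le> M"
  shows "ennreal (1 / s) * truncated_riesz s ((M\<^sup>2) powr (- s)) \<epsilon> \<le>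
      (\<integral>\<^sup>+ h. ennreal \<bar>h\<bar> * indicator {- M..M} h * film_kernel s \<epsilon> h \<partial>lborel)" (is ?lower)
    and "(\<integral>\<^sup>+ h. ennreal \<bar>h\<bar> * indicator {- M..M} h * film_kernel s \<epsilon> h \<partial>lborel) \<le>
      ennreal (1 / s) * truncated_riesz s ((2 * M\<^sup>2) powr (- s)) \<epsilon>" (is ?upper)
proof -
  have lo: "(M\<^sup>2 + z\<^sup>2) powr (- s) \<le> (M\<^sup>2) powr (- s)" for z
    using assms by (intro powr_mono2') auto
  have hi: "(2 * M\<^sup>2) powr (- s) \<le> (M\<^sup>2 + z\<^sup>2) powr (- s)" if "\<bar>z\<bar> \<le> M" for z
    using assms power_mono[OF that, of 2] by (intro powr_mono2') (auto intro!: add_pos_nonneg)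
  show ?lower
    using assms unfolding truncated_riesz_cmult[OF assms(1)] nn_integral_abs_film_kernel[OF assms(1) less_imp_le[OF assms(2)]]
    by (intro nn_integral_mono mult_right_mono ennreal_leI divide_right_mono diff_left_mono lo) auto
  have "(\<integral>\<^sup>+ x. ennreal ((\<bar>x - y\<bar> powr (- 2 * s) - (M\<^sup>2 + (x - y)\<^sup>2) powr (- s)) / s) * indicator {0<..<\<epsilon>} x \<partial>lborel) * indicator {0<..<\<epsilon>} y
    \<le> (\<integral>\<^sup>+ x. ennreal ((\<bar>x - y\<bar> powr (- 2 * s) - (2 * M\<^sup>2) powr (- s)) / s) * indicator {0<..<\<epsilon>} x \<partial>lborel) * indicator {0<..<\<epsilon>} y" for y
  proof (cases "y \<in> {0<..<\<epsilon>}")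
    case True
    show ?thesis
    proof (rule mult_right_mono[OF nn_integral_mono])
      fix x
      show "ennreal ((\<bar>x - y\<bar> powr (- 2 * s) - (M\<^sup>2 + (x - y)\<^sup>2) powr (- s)) / s) * indicator {0<..<\<epsilon>} x
        \<le> ennreal ((\<bar>x - y\<bar> powr (- 2 * s) - (2 * M\<^sup>2) powr (- s)) / s) * indicator {0<..<\<epsilon>} x"
      proof (cases "x \<in> {0<..<\<epsilon>}")
        case x: True
        then show ?thesis
          using assms True by (intro mult_right_mono ennreal_leI divide_right_mono diff_left_mono hi) auto
      qed simp
    qed simp
  qed simp
  then show ?upper
    unfolding truncated_riesz_cmult[OF assms(1)] nn_integral_abs_film_kernel[OF assms(1) less_imp_le[OF assms(2)]]
    by (intro nn_integral_mono)
qed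

subsection \<open>Two-sided bounds and limits\<close>

text \<open>The shape of both bounds for the seminorm: \<open>S\<close> is the sum of the squared jumps, \<open>q\<close> is \<open>M\<^sup>2\<close> or
  \<open>2 * M\<^sup>2\<close>, and \<open>D\<close> accounts for the pairs at horizontal distance larger than \<open>M\<close>.\<close>

definition film_profile :: "real \<Rightarrow> real \<Rightarrow> real \<Rightarrow> real \<Rightarrow> real \<Rightarrow> real" where
  "film_profile S D q s \<epsilon> = S * (1 / s * (\<epsilon> powr (2 - 2 * s) / ((1 - 2 * s) * (1 - s)) - q powr (- s) * \<epsilon>\<^sup>2)) + D * \<epsilon>\<^sup>2"

text \<open>From \<open>\<epsilon>\<^sup>2 \<le> q\<close> the subtracted term is at most
  \<open>\<epsilon> powr (2 - 2 * s)\<close>, and the denominator is at most 1. The sign allows the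
  near and far parts of the upper bound to be added inside \<open>ennreal\<close>.\<close>

lemma truncated_riesz_nonneg:
  fixes s \<epsilon> q :: real
  assumes "0 < s" "s < 1 / 2" "0 < \<epsilon>" "\<epsilon>\<^sup>2 \<le> q"
  shows "0 \<le> \<epsilon> powr (2 - 2 * s) / ((1 - 2 * s) * (1 - s)) - q powr (- s) * \<epsilon>\<^sup>2"
proof -
  have "q powr (- s) * \<epsilon>\<^sup>2 \<le> (\<epsilon>\<^sup>2) powr (- s) * \<epsilon>\<^sup>2"
    using assms by (intro mult_right_mono powr_mono2') auto
  also have "\<dots> = \<epsilon> powr (2 - 2 * s)"
  proof -
    have "\<epsilon> powr (2 - 2 * s) = \<epsilon> powr (- 2 * s) * \<epsilon> powr 2"
      unfolding powr_add[symmetric] by simp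
    then show ?thesis
      unfolding power2_powr_uminus[OF assms(3)] using assms by simp
  qed
  also have "\<dots> \<le> \<epsilon> powr (2 - 2 * s) / ((1 - 2 * s) * (1 - s))"
  proof -
    have "(1 - 2 * s) * (1 - s) \<le> 1 * 1"
      using assms by (intro mult_mono) auto
    then show ?thesis
      using assms by (simp add: le_divide_eq mult_left_le)
  qed
  finally show ?thesis by simp
qed

lemma truncated_riesz_powr_eq:
  fixes s \<epsilon> q :: real
  assumes "0 < s" "s < 1 / 2" "0 < \<epsilon>" "\<epsilon>\<^sup>2 \<le> q"
  shows "truncated_riesz s (q powr (- s)) \<epsilon> = ennreal (\<epsilon> powr (2 - 2 * s) / ((1 - 2 * s) * (1 - s)) - q powr (- s) * \<epsilon>\<^sup>2)"
proof (rule truncated_riesz_eq)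
  have "q powr (- s) \<le> (\<epsilon>\<^sup>2) powr (- s)"
    using assms by (intro powr_mono2') auto
  then show "q powr (- s) \<le> \<epsilon> powr (- 2 * s)"
    using power2_powr_uminus[OF assms(3), of s] by simp
qed (use assms in auto)

text \<open>The integral is split at \<open>\<bar>h\<bar> = M\<close>. The near part is
  \<open>S\<close> times the integral just estimated. The lower bound drops the far part; the upper
  bound multiplies the crude bounds for increment and kernel by the length
  \<open>2 * (b - a)\<close> of the support, which yields
  \<open>D * \<epsilon>\<^sup>2\<close>.\<close>

lemma increment_film_kernel_bounds:
  assumes P: "finite P" and gap: "\<And>t t'. t \<in> P \<Longrightarrow> t' \<in> P \<Longrightarrow> t \<noteq> t' \<Longrightarrow> M < dist t t'"
    and end_gap: "\<And>t. t \<in> P \<Longrightarrow> a + M < t \<and> t + M < b"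
    and ab: "a < b" and M: "0 < M" "M \<le> 1"
    and s: "0 < s" "s < 1 / 2" and \<epsilon>: "0 < \<epsilon>" "\<epsilon> \<le> M"
    and S_def: "S = (\<Sum>t\<in>P. (d t)\<^sup>2)"
    and D_def: "D = (\<Sum>t\<in>P. \<bar>d t\<bar>)\<^sup>2 * (b - a) * (2 * (b - a)) / M ^ 3"
  shows "ennreal (film_profile S 0 (M\<^sup>2) s \<epsilon>) \<le>
      (\<integral>\<^sup>+ h. increment_sq a b (\<lambda>x. k + heaviside_sum P d x) h * film_kernel s \<epsilon> h \<partial>lborel)" (is ?lower)
    and "(\<integral>\<^sup>+ h. increment_sq a b (\<lambda>x. k + heaviside_sum P d x) h * film_kernel s \<epsilon> h \<partial>lborel) \<le>
      ennreal (film_profile S D (2 * M\<^sup>2) s \<epsilon>)" (is ?upper)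
proof -
  define C where "C = (\<Sum>t\<in>P. \<bar>d t\<bar>)\<^sup>2"
  let ?I = "increment_sq a b (\<lambda>x. k + heaviside_sum P d x)"
  have S: "0 \<le> S"
    unfolding S_def by (intro sum_nonneg) auto
  have C: "0 \<le> C"
    by (simp add: C_def)
  have near: "?I h = ennreal S * (ennreal \<bar>h\<bar> * indicator {- M..M} h)" if "\<bar>h\<bar> \<le> M" for h
  proof -
    have "h \<in> {- M..M}"
      using that by auto
    moreover have "?I h = ennreal (\<bar>h\<bar> * S)"
      unfolding S_def by (rule increment_sq_heaviside[OF P gap end_gap that])
    ultimately show ?thesis
      using S by (simp add: ennreal_mult mult.commute)
  qed
  have far: "?I h \<le> ennreal (C * (b - a)) * indicator {a - b..b - a} h" for h
    using ab heaviside_sum_diff_sq_le[of P d] by (intro increment_sq_le) (auto simp: C_def)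
  let ?K = "film_kernel s \<epsilon>"
  let ?N = "\<integral>\<^sup>+ h. ennreal \<bar>h\<bar> * indicator {- M..M} h * ?K h \<partial>lborel"
  have \<epsilon>M: "\<epsilon>\<^sup>2 \<le> M\<^sup>2"
    using \<epsilon> by (intro power_mono) auto
  then have \<epsilon>2M: "\<epsilon>\<^sup>2 \<le> 2 * M\<^sup>2"
    using zero_le_power2[of M] by linarith
  have "ennreal (film_profile S 0 (M\<^sup>2) s \<epsilon>) = ennreal S * (ennreal (1 / s) * truncated_riesz s ((M\<^sup>2) powr (- s)) \<epsilon>)"
    unfolding truncated_riesz_powr_eq[OF s \<epsilon>(1) \<epsilon>M] film_profile_def using S s by (simp flip: ennreal_mult')
  also have "\<dots> \<le> ennreal S * ?N"
    using s M \<epsilon> by (intro mult_left_mono nn_integral_abs_film_kernel_bounds) auto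
  also have "\<dots> = (\<integral>\<^sup>+ h. ennreal S * (ennreal \<bar>h\<bar> * indicator {- M..M} h * ?K h) \<partial>lborel)"
    by (rule nn_integral_cmult[symmetric]) measurable
  also have "\<dots> \<le> (\<integral>\<^sup>+ h. ?I h * ?K h \<partial>lborel)"
  proof (rule nn_integral_mono)
    fix h
    show "ennreal S * (ennreal \<bar>h\<bar> * indicator {- M..M} h * ?K h) \<le> ?I h * ?K h"
    proof (cases "\<bar>h\<bar> \<le> M")
      case True
      then show ?thesis
        by (simp add: near mult.assoc)
    next
      case False
      then have "h \<notin> {- M..M}"
        by auto
      then show ?thesis
        by simp
    qed
  qed
  finally show ?lower .
  have "(\<integral>\<^sup>+ h. ?I h * ?K h \<partial>lborel) \<le>
      (\<integral>\<^sup>+ h. ennreal S * (ennreal \<bar>h\<bar> * indicator {- M..M} h * ?K h) +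
        ennreal (C * (b - a) * (\<epsilon>\<^sup>2 / M ^ 3)) * indicator {a - b..b - a} h \<partial>lborel)"
  proof (rule nn_integral_mono)
    fix h
    show "?I h * ?K h \<le> ennreal S * (ennreal \<bar>h\<bar> * indicator {- M..M} h * ?K h) +
        ennreal (C * (b - a) * (\<epsilon>\<^sup>2 / M ^ 3)) * indicator {a - b..b - a} h"
    proof (cases "\<bar>h\<bar> \<le> M")
      case True
      then show ?thesis
        by (simp add: near mult.assoc)
    next
      case False
      then have "?I h * ?K h \<le> ennreal (C * (b - a)) * indicator {a - b..b - a} h * ennreal (\<epsilon>\<^sup>2 / M ^ 3)"
        using s M \<epsilon> by (intro mult_mono far film_kernel_le) auto
      also have "\<dots> = ennreal (C * (b - a) * (\<epsilon>\<^sup>2 / M ^ 3)) * indicator {a - b..b - a} h"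
        using C ab M by (subst ennreal_mult) (auto simp: mult_ac)
      finally show ?thesis
        by (simp add: add_increasing)
    qed
  qed
  also have "\<dots> = ennreal S * ?N + ennreal (C * (b - a) * (\<epsilon>\<^sup>2 / M ^ 3)) * ennreal (2 * (b - a))"
    using ab by (subst nn_integral_add, measurable, subst nn_integral_cmult, measurable,
        subst nn_integral_cmult_indicator) auto
  also have "ennreal (C * (b - a) * (\<epsilon>\<^sup>2 / M ^ 3)) * ennreal (2 * (b - a)) = ennreal (D * \<epsilon>\<^sup>2)"
    using C ab M by (subst ennreal_mult[symmetric]) (auto simp: D_def C_def mult_ac)
  also have "ennreal S * ?N \<le> ennreal S * (ennreal (1 / s) * truncated_riesz s ((2 * M\<^sup>2) powr (- s)) \<epsilon>)"
    using s M \<epsilon> by (intro mult_left_mono nn_integral_abs_film_kernel_bounds) auto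
  also have "ennreal S * (ennreal (1 / s) * truncated_riesz s ((2 * M\<^sup>2) powr (- s)) \<epsilon>) + ennreal (D * \<epsilon>\<^sup>2) =
      ennreal (film_profile S D (2 * M\<^sup>2) s \<epsilon>)"
  proof -
    have "0 \<le> D"
      using ab M by (simp add: D_def)
    moreover note truncated_riesz_nonneg[OF s \<epsilon>(1) \<epsilon>2M]
    ultimately show ?thesis
      unfolding truncated_riesz_powr_eq[OF s \<epsilon>(1) \<epsilon>2M] film_profile_def using S s
      by (subst ennreal_plus) (simp_all flip: ennreal_mult')
  qed
  finally show ?upper
    by (simp add: add_mono)
qed

section \<open>Asymptotics of the profile in the three regimes\<close>

lemma powr_two_minus:
  fixes \<epsilon> s :: real
  assumes "0 < \<epsilon>"
  shows "\<epsilon> powr (2 - 2 * s) = \<epsilon>\<^sup>2 / (\<epsilon> powr s)\<^sup>2"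
proof -
  have "(\<epsilon> powr s)\<^sup>2 = \<epsilon> powr (2 * s)"
    unfolding power2_eq_square powr_add[symmetric] by simp
  then show ?thesis
    using assms by (simp add: powr_diff)
qed

text \<open>Up to sign this is the difference quotient of \<open>q powr (- s)\<close> at
  \<open>s = 0\<close>.\<close>

lemma tendsto_uminus_div_powr:
  assumes "0 < q"
  shows "((\<lambda>s. (1 - q powr (- s)) / s) \<longlongrightarrow> ln q) (at_right (0::real))"
  using assms by real_asymp

context
  fixes s :: "real \<Rightarrow> real"
  assumes s: "\<forall>\<^sub>F \<epsilon> in at_right 0. 0 < s \<epsilon> \<and> s \<epsilon> < 1 / 2"
begin

lemma eventually_small: "\<forall>\<^sub>F \<epsilon> in at_right 0. 0 < s \<epsilon> \<and> s \<epsilon> < 1 / 2 \<and> 0 < \<epsilon> \<and> \<epsilon> < (1::real)"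
  using s eventually_at_right_real[of 0 1] by (auto elim: eventually_elim2)

lemma s_log_pos: "\<forall>\<^sub>F \<epsilon> in at_right 0. 0 < s \<epsilon> * \<bar>ln \<epsilon>\<bar>"
  using eventually_small by eventually_elim (intro mult_pos_pos, auto)

text \<open>For \<open>\<epsilon> < 1\<close> the logarithm is negative. This links the regimes,
  stated through \<open>s \<epsilon> * \<bar>ln \<epsilon>\<bar>\<close>, to the value of
  \<open>\<rho>\<close>.\<close>

lemma powr_s_eq: "\<forall>\<^sub>F \<epsilon> in at_right 0. \<epsilon> powr s \<epsilon> = exp (- (s \<epsilon> * \<bar>ln \<epsilon>\<bar>))"
  using eventually_small by eventually_elim (auto simp: powr_def)

end

context
  fixes s :: "real \<Rightarrow> real" and \<rho> S D q :: real
  assumes s: "\<forall>\<^sub>F \<epsilon> in at_right 0. 0 < s \<epsilon> \<and> s \<epsilon> < 1 / 2"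
    and s0: "(s \<longlongrightarrow> 0) (at_right 0)"
    and \<rho>: "((\<lambda>\<epsilon>. \<epsilon> powr s \<epsilon>) \<longlongrightarrow> \<rho>) (at_right 0)"
    and q: "0 < q"
begin

lemma tendsto_riesz_constant: "((\<lambda>\<epsilon>. 1 / ((1 - 2 * s \<epsilon>) * (1 - s \<epsilon>))) \<longlongrightarrow> 1) (at_right 0)"
  using s0 by (auto intro!: tendsto_eq_intros)

lemma tendsto_powr_s: "((\<lambda>\<epsilon>. q powr (- s \<epsilon>)) \<longlongrightarrow> 1) (at_right 0)"
  using s0 q by (auto intro!: tendsto_eq_intros)

text \<open>With \<open>r = \<epsilon> powr s \<epsilon>\<close> the scaling is
  \<open>\<epsilon>\<^sup>2 / (s * r\<^sup>2)\<close>. Division by it leaves \<open>S\<close> times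
  the constant tending to 1, plus terms carrying a factor \<open>r\<^sup>2\<close> that tends to
  0.\<close>

lemma film_profile_limit_rho_0:
  assumes "\<rho> = 0"
  shows "((\<lambda>\<epsilon>. film_profile S D q (s \<epsilon>) \<epsilon> / scaling \<rho> (s \<epsilon>) \<epsilon>) \<longlongrightarrow> S) (at_right 0)"
proof -
  have "((\<lambda>\<epsilon>. S * (1 / ((1 - 2 * s \<epsilon>) * (1 - s \<epsilon>)) - q powr (- s \<epsilon>) * (\<epsilon> powr s \<epsilon>)\<^sup>2) + D * s \<epsilon> * (\<epsilon> powr s \<epsilon>)\<^sup>2)
      \<longlongrightarrow> S * (1 - 1 * \<rho>\<^sup>2) + D * 0 * \<rho>\<^sup>2) (at_right 0)"
    by (intro tendsto_intros tendsto_riesz_constant tendsto_powr_s \<rho> s0)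
  moreover have "\<forall>\<^sub>F \<epsilon> in at_right 0. S * (1 / ((1 - 2 * s \<epsilon>) * (1 - s \<epsilon>)) - q powr (- s \<epsilon>) * (\<epsilon> powr s \<epsilon>)\<^sup>2) + D * s \<epsilon> * (\<epsilon> powr s \<epsilon>)\<^sup>2
      = film_profile S D q (s \<epsilon>) \<epsilon> / scaling \<rho> (s \<epsilon>) \<epsilon>"
    using eventually_small[OF s]
  proof eventually_elim
    case (elim \<epsilon>)
    define r where "r = \<epsilon> powr s \<epsilon>"
    define c where "c = (1 - 2 * s \<epsilon>) * (1 - s \<epsilon>)"
    have "0 < r" "0 < c"
      using elim by (auto simp: r_def c_def)
    then show ?case
      using elim assms
      unfolding film_profile_def scaling_def powr_two_minus[OF conjunct1[OF conjunct2[OF conjunct2[OF elim]]]]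
        r_def[symmetric] c_def[symmetric]
      by (simp add: field_simps)
  qed
  ultimately show ?thesis
    using assms by (simp add: Lim_transform_eventually)
qed

text \<open>Division by \<open>\<epsilon>\<^sup>2 / s\<close> keeps both terms of the bracket, which
  tend to \<open>1 / \<rho>\<^sup>2\<close> and 1, while the far contribution becomes
  \<open>D * s\<close>.\<close>

lemma film_profile_limit_rho_between:
  assumes "0 < \<rho>" "\<rho> < 1"
  shows "((\<lambda>\<epsilon>. film_profile S D q (s \<epsilon>) \<epsilon> / scaling \<rho> (s \<epsilon>) \<epsilon>) \<longlongrightarrow> (1 - \<rho>\<^sup>2) / \<rho>\<^sup>2 * S) (at_right 0)"
proof -
  have "((\<lambda>\<epsilon>. S * (1 / ((1 - 2 * s \<epsilon>) * (1 - s \<epsilon>)) / (\<epsilon> powr s \<epsilon>)\<^sup>2 - q powr (- s \<epsilon>)) + D * s \<epsilon>)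
      \<longlongrightarrow> S * (1 / \<rho>\<^sup>2 - 1) + D * 0) (at_right 0)"
    using assms by (intro tendsto_intros tendsto_riesz_constant tendsto_powr_s \<rho> s0) auto
  moreover have "\<forall>\<^sub>F \<epsilon> in at_right 0. S * (1 / ((1 - 2 * s \<epsilon>) * (1 - s \<epsilon>)) / (\<epsilon> powr s \<epsilon>)\<^sup>2 - q powr (- s \<epsilon>)) + D * s \<epsilon>
      = film_profile S D q (s \<epsilon>) \<epsilon> / scaling \<rho> (s \<epsilon>) \<epsilon>"
    using eventually_small[OF s]
  proof eventually_elim
    case (elim \<epsilon>)
    define r where "r = \<epsilon> powr s \<epsilon>"
    define c where "c = (1 - 2 * s \<epsilon>) * (1 - s \<epsilon>)"
    have "0 < r" "0 < c"
      using elim by (auto simp: r_def c_def)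
    then show ?case
      using elim assms
      unfolding film_profile_def scaling_def powr_two_minus[OF conjunct1[OF conjunct2[OF conjunct2[OF elim]]]]
        r_def[symmetric] c_def[symmetric]
      by (simp add: field_simps)
  qed
  moreover have "S * (1 / \<rho>\<^sup>2 - 1) + D * 0 = (1 - \<rho>\<^sup>2) / \<rho>\<^sup>2 * S"
    using assms by (simp add: field_simps)
  ultimately show ?thesis
    by (simp add: Lim_transform_eventually)
qed

text \<open>With \<open>c = (1 - 2 * s) * (1 - s)\<close> the bracket
  \<open>1 / (c * r\<^sup>2) - q powr (- s)\<close> now tends to 0. It is written as \<open>(1 /
  r\<^sup>2 - 1) + (1 / c - 1) / r\<^sup>2 + (1 - q powr (- s))\<close>. Divided by
  \<open>s * \<bar>ln \<epsilon>\<bar>\<close>, the first summand tends to 2; the others are of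
  order \<open>s\<close> and leave only a multiple of
  \<open>1 / \<bar>ln \<epsilon>\<bar>\<close>.\<close>

lemma film_profile_limit_rho_1:
  assumes "\<rho> = 1" and log: "((\<lambda>\<epsilon>. s \<epsilon> * \<bar>ln \<epsilon>\<bar>) \<longlongrightarrow> 0) (at_right 0)"
  shows "((\<lambda>\<epsilon>. film_profile S D q (s \<epsilon>) \<epsilon> / scaling \<rho> (s \<epsilon>) \<epsilon>) \<longlongrightarrow> 2 * S) (at_right 0)"
proof -
  let ?\<tau> = "\<lambda>\<epsilon>. s \<epsilon> * \<bar>ln \<epsilon>\<bar>"
  let ?c = "\<lambda>\<epsilon>. (1 - 2 * s \<epsilon>) * (1 - s \<epsilon>)"
  \<comment> \<open>The auxiliary limits are one-sided at 0, so \<open>s\<close> and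
    \<open>s * \<bar>ln \<epsilon>\<bar>\<close> must approach 0 through positive values.\<close>
  have s_right: "filterlim s (at_right 0) (at_right 0)"
    using s0 s by (auto simp: filterlim_at elim: eventually_mono)
  have \<tau>_right: "filterlim ?\<tau> (at_right 0) (at_right 0)"
    using log s_log_pos[OF s] by (auto simp: filterlim_at elim: eventually_mono)
  have "((\<lambda>x. (exp (2 * x) - 1) / x) \<longlongrightarrow> 2) (at_right (0::real))"
    by real_asymp
  from filterlim_compose[OF this \<tau>_right]
  have exp_lim: "((\<lambda>\<epsilon>. (exp (2 * ?\<tau> \<epsilon>) - 1) / ?\<tau> \<epsilon>) \<longlongrightarrow> 2) (at_right 0)" .
  have q_lim: "((\<lambda>\<epsilon>. (1 - q powr (- s \<epsilon>)) / s \<epsilon>) \<longlongrightarrow> ln q) (at_right 0)"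
    by (rule filterlim_compose[OF tendsto_uminus_div_powr[OF q] s_right])
  have inv_log: "((\<lambda>\<epsilon>. 1 / \<bar>ln \<epsilon>\<bar>) \<longlongrightarrow> 0) (at_right (0::real))"
    by real_asymp
  have "((\<lambda>\<epsilon>. S * ((exp (2 * ?\<tau> \<epsilon>) - 1) / ?\<tau> \<epsilon> +
        (3 - 2 * s \<epsilon>) * (1 / ?c \<epsilon>) / (\<epsilon> powr s \<epsilon>)\<^sup>2 * (1 / \<bar>ln \<epsilon>\<bar>) +
        (1 - q powr (- s \<epsilon>)) / s \<epsilon> * (1 / \<bar>ln \<epsilon>\<bar>)) + D * (1 / \<bar>ln \<epsilon>\<bar>))
      \<longlongrightarrow> S * (2 + (3 - 2 * 0) * 1 / \<rho>\<^sup>2 * 0 + ln q * 0) + D * 0) (at_right 0)"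
    using assms(1)
    by (intro tendsto_intros tendsto_riesz_constant exp_lim q_lim inv_log \<rho> s0) auto
  moreover have "\<forall>\<^sub>F \<epsilon> in at_right 0. S * ((exp (2 * ?\<tau> \<epsilon>) - 1) / ?\<tau> \<epsilon> +
        (3 - 2 * s \<epsilon>) * (1 / ?c \<epsilon>) / (\<epsilon> powr s \<epsilon>)\<^sup>2 * (1 / \<bar>ln \<epsilon>\<bar>) +
        (1 - q powr (- s \<epsilon>)) / s \<epsilon> * (1 / \<bar>ln \<epsilon>\<bar>)) + D * (1 / \<bar>ln \<epsilon>\<bar>)
      = film_profile S D q (s \<epsilon>) \<epsilon> / scaling \<rho> (s \<epsilon>) \<epsilon>"
    using eventually_small[OF s] powr_s_eq[OF s]
  proof eventually_elim
    case (elim \<epsilon>)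
    define r where "r = \<epsilon> powr s \<epsilon>"
    define c where "c = ?c \<epsilon>"
    define l where "l = \<bar>ln \<epsilon>\<bar>"
    have pos: "0 < r" "0 < c" "0 < l" "0 < \<epsilon>" "0 < s \<epsilon>"
      using elim by (auto simp: r_def c_def l_def)
    have exp_r: "exp (2 * (s \<epsilon> * l)) = 1 / r\<^sup>2"
      unfolding r_def elim(2) l_def[symmetric] by (simp add: exp_minus field_simps flip: exp_double)
    \<comment> \<open>The factor \<open>3 - 2 * s\<close> is the exact quotient of
      \<open>1 - c\<close> by \<open>s\<close>.\<close>
    have c: "(3 - 2 * s \<epsilon>) * (1 / c) = (1 / c - 1) / s \<epsilon>"
    proof -
      have "1 - c = (3 - 2 * s \<epsilon>) * s \<epsilon>"
        by (simp add: c_def algebra_simps)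
      moreover have "(1 / c - 1) / s \<epsilon> = (1 - c) / (c * s \<epsilon>)"
        using pos by (simp add: field_simps)
      ultimately show ?thesis
        using pos by simp
    qed
    show ?case
      using pos assms(1)
      unfolding film_profile_def scaling_def powr_two_minus[OF pos(4)]
        r_def[symmetric] c_def[symmetric] l_def[symmetric] exp_r c
      by (simp add: field_simps)
  qed
  ultimately show ?thesis
    by (simp add: Lim_transform_eventually mult.commute)
qed

end

text \<open>Sandwich argument in \<open>ennreal\<close>: multiplication by the nonnegative factor
  \<open>1 / k\<close> is monotone and commutes with the embedding of the reals.\<close>

lemma tendsto_scaled_gagliardo_sq:
  assumes bounds: "\<forall>\<^sub>F \<epsilon> in at_right 0. ennreal (l \<epsilon>) \<le> G \<epsilon> \<and> G \<epsilon> \<le> ennreal (h \<epsilon>)"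
    and pos: "\<forall>\<^sub>F \<epsilon> in at_right 0. 0 \<le> k \<epsilon>"
    and l: "((\<lambda>\<epsilon>. l \<epsilon> / k \<epsilon>) \<longlongrightarrow> L) (at_right 0)"
    and h: "((\<lambda>\<epsilon>. h \<epsilon> / k \<epsilon>) \<longlongrightarrow> L) (at_right 0)"
  shows "((\<lambda>\<epsilon>. ennreal (1 / k \<epsilon>) * G \<epsilon>) \<longlongrightarrow> ennreal L) (at_right (0::real))"
proof (rule tendsto_sandwich)
  show "\<forall>\<^sub>F \<epsilon> in at_right 0. ennreal (l \<epsilon> / k \<epsilon>) \<le> ennreal (1 / k \<epsilon>) * G \<epsilon>"
    using bounds pos
  proof eventually_elim
    case (elim \<epsilon>)
    have "ennreal (l \<epsilon> / k \<epsilon>) = ennreal (1 / k \<epsilon>) * ennreal (l \<epsilon>)"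
      using elim by (simp flip: ennreal_mult')
    then show ?case
      using elim by (simp add: mult_left_mono)
  qed
  show "\<forall>\<^sub>F \<epsilon> in at_right 0. ennreal (1 / k \<epsilon>) * G \<epsilon> \<le> ennreal (h \<epsilon> / k \<epsilon>)"
    using bounds pos
  proof eventually_elim
    case (elim \<epsilon>)
    have "ennreal (h \<epsilon> / k \<epsilon>) = ennreal (1 / k \<epsilon>) * ennreal (h \<epsilon>)"
      using elim by (simp flip: ennreal_mult')
    then show ?case
      using elim by (simp add: mult_left_mono)
  qed
qed (intro tendsto_ennrealI l h)+

theorem proposition7p3:
  fixes a b \<rho> :: real
    and s :: "real \<Rightarrow> real"
    and v :: "real \<Rightarrow> real"
    and u :: "real \<Rightarrow> real \<times> real \<Rightarrow> real"
  assumes "a < b"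
    and "\<forall>\<^sub>F \<epsilon> in at_right 0. 0 < s \<epsilon> \<and> s \<epsilon> < 1 / 2"
    and "(s \<longlongrightarrow> 0) (at_right 0)"
    and "((\<lambda>\<epsilon>. \<epsilon> powr s \<epsilon>) \<longlongrightarrow> \<rho>) (at_right 0)"
    and "\<rho> \<in> {0..1}"
    and "piecewise_constant_on a b v"
    and "\<And>\<epsilon> x1 x2. (x1, x2) \<in> thin_film a b \<epsilon> \<Longrightarrow> u \<epsilon> (x1, x2) = v x1"
  shows "(much_greater s (\<lambda>\<epsilon>. 1 / \<bar>ln \<epsilon>\<bar>) \<longrightarrow>
            ((\<lambda>\<epsilon>. ennreal (1 / scaling \<rho> (s \<epsilon>) \<epsilon>) * gagliardo_sq (s \<epsilon>) (thin_film a b \<epsilon>) (u \<epsilon>))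
              \<longlongrightarrow> ennreal (\<Sum>t\<in>jump_set a b v. \<bar>right_lim v t - left_lim v t\<bar>\<^sup>2)) (at_right 0)) \<and>
         (comparable_inverse_log s \<longrightarrow>
            0 < \<rho> \<and> \<rho> < 1 \<and>
            ((\<lambda>\<epsilon>. ennreal (1 / scaling \<rho> (s \<epsilon>) \<epsilon>) * gagliardo_sq (s \<epsilon>) (thin_film a b \<epsilon>) (u \<epsilon>))
              \<longlongrightarrow> ennreal ((1 - \<rho>\<^sup>2) / \<rho>\<^sup>2 *
                     (\<Sum>t\<in>jump_set a b v. \<bar>right_lim v t - left_lim v t\<bar>\<^sup>2))) (at_right 0)) \<and>
         (much_greater (\<lambda>\<epsilon>. 1 / \<bar>ln \<epsilon>\<bar>) s \<and> much_greater s (\<lambda>\<epsilon>. \<epsilon>\<^sup>2 * (1 / \<bar>ln \<epsilon>\<bar>)) \<longrightarrow>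
            ((\<lambda>\<epsilon>. ennreal (1 / scaling \<rho> (s \<epsilon>) \<epsilon>) * gagliardo_sq (s \<epsilon>) (thin_film a b \<epsilon>) (u \<epsilon>))
              \<longlongrightarrow> ennreal (2 * (\<Sum>t\<in>jump_set a b v. \<bar>right_lim v t - left_lim v t\<bar>\<^sup>2))) (at_right 0))"
proof -
  note s = assms(2) and s0 = assms(3) and \<rho> = assms(4)
  obtain P d k where P: "finite P" "P \<subseteq> {a<..<b}"
    and v: "AE x in lebesgue. x \<in> {a<..<b} \<longrightarrow> v x = k + heaviside_sum P d x"
    using piecewise_constant_on_heaviside[OF assms(6)] by metis
  define S where "S = (\<Sum>t\<in>P. (d t)\<^sup>2)"
  have jumps: "(\<Sum>t\<in>jump_set a b v. \<bar>right_lim v t - left_lim v t\<bar>\<^sup>2) = S"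
    unfolding S_def by (rule sum_jumps_sq[OF P v])
  \<comment> \<open>Including \<open>a\<close> and \<open>b\<close> among the points also keeps the
    jumps at distance more than \<open>M0\<close> from the ends. The cap at 1 below is what the far
    kernel estimate requires.\<close>
  obtain M0 where M0: "M0 > 0" and M0_gap: "\<And>x y. x \<in> insert a (insert b P) \<Longrightarrow> y \<in> insert a (insert b P) \<Longrightarrow> x \<noteq> y \<Longrightarrow> M0 < dist x y"
    using finite_set_gap[of "insert a (insert b P)"] P(1) by (metis finite_insert)
  define M where "M = min M0 1"
  have M: "0 < M" "M \<le> 1"
    using M0 by (auto simp: M_def)
  have gap: "M < dist t t'" if "t \<in> P" "t' \<in> P" "t \<noteq> t'" for t t'
    using M0_gap[of t t'] that by (auto simp: M_def)
  have end_gap: "a + M < t \<and> t + M < b" if "t \<in> P" for t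
    using M0_gap[of t a] M0_gap[of b t] that P(2) by (auto simp: M_def dist_real_def)
  define G where "G \<epsilon> = gagliardo_sq (s \<epsilon>) (thin_film a b \<epsilon>) (u \<epsilon>)" for \<epsilon>
  have G: "G \<epsilon> = (\<integral>\<^sup>+ h. increment_sq a b (\<lambda>x. k + heaviside_sum P d x) h * film_kernel (s \<epsilon>) \<epsilon> h \<partial>lborel)" for \<epsilon>
    unfolding G_def by (rule gagliardo_sq_thin_film[OF _ v assms(7)]) measurable
  define D where "D = (\<Sum>t\<in>P. \<bar>d t\<bar>)\<^sup>2 * (b - a) * (2 * (b - a)) / M ^ 3"
  have bounds: "\<forall>\<^sub>F \<epsilon> in at_right 0. ennreal (film_profile S 0 (M\<^sup>2) (s \<epsilon>) \<epsilon>) \<le> G \<epsilon> \<and> G \<epsilon> \<le> ennreal (film_profile S D (2 * M\<^sup>2) (s \<epsilon>) \<epsilon>)"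
    using s eventually_at_right_real[OF M(1)]
  proof eventually_elim
    case (elim \<epsilon>)
    then show ?case
      unfolding G
      by (intro conjI increment_film_kernel_bounds[OF P(1) gap end_gap assms(1) M _ _ _ _ S_def D_def]) auto
  qed
  have pos: "\<forall>\<^sub>F \<epsilon> in at_right 0. 0 \<le> scaling \<rho> (s \<epsilon>) \<epsilon>"
    using s by eventually_elim (simp add: scaling_def)
  have q: "0 < M\<^sup>2" "0 < 2 * M\<^sup>2"
    using M by auto
  note lim = tendsto_scaled_gagliardo_sq[OF bounds pos]
  have powr_exp: "\<forall>\<^sub>F \<epsilon> in at_right 0. \<epsilon> powr s \<epsilon> = exp (- (s \<epsilon> * \<bar>ln \<epsilon>\<bar>))"
    by (rule powr_s_eq[OF s])
  \<comment> \<open>Each regime determines the limit of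
    \<open>s \<epsilon> * \<bar>ln \<epsilon>\<bar>\<close>, hence \<open>\<rho>\<close>, and
    thereby selects the branch of \<open>scaling\<close>.\<close>
  have \<rho>_unique: "\<rho> = c" if "((\<lambda>\<epsilon>. exp (- (s \<epsilon> * \<bar>ln \<epsilon>\<bar>))) \<longlongrightarrow> c) (at_right 0)" for c
  proof -
    have "\<forall>\<^sub>F \<epsilon> in at_right 0. exp (- (s \<epsilon> * \<bar>ln \<epsilon>\<bar>)) = \<epsilon> powr s \<epsilon>"
      using powr_exp by eventually_elim (rule sym)
    with that have "((\<lambda>\<epsilon>. \<epsilon> powr s \<epsilon>) \<longlongrightarrow> c) (at_right 0)"
      by (rule Lim_transform_eventually)
    then show ?thesis
      using \<rho> by (intro tendsto_unique[OF trivial_limit_at_right_real])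
  qed
  have "((\<lambda>\<epsilon>. ennreal (1 / scaling \<rho> (s \<epsilon>) \<epsilon>) * G \<epsilon>) \<longlongrightarrow> ennreal S) (at_right 0)"
    if "much_greater s (\<lambda>\<epsilon>. 1 / \<bar>ln \<epsilon>\<bar>)"
  proof -
    have "((\<lambda>\<epsilon>. inverse (s \<epsilon> * \<bar>ln \<epsilon>\<bar>)) \<longlongrightarrow> 0) (at_right 0)"
      using that by (simp add: much_greater_def field_simps)
    \<comment> \<open>Positivity of the reciprocal is what turns its limit 0 into divergence of
      \<open>s \<epsilon> * \<bar>ln \<epsilon>\<bar>\<close> to plus infinity.\<close>
    moreover have "\<forall>\<^sub>F \<epsilon> in at_right 0. 0 < inverse (s \<epsilon> * \<bar>ln \<epsilon>\<bar>)"
      using s_log_pos[OF s] by eventually_elim (rule positive_imp_inverse_positive)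
    ultimately have "filterlim (\<lambda>\<epsilon>. inverse (inverse (s \<epsilon> * \<bar>ln \<epsilon>\<bar>))) at_top (at_right 0)"
      by (rule filterlim_inverse_at_top)
    then have "filterlim (\<lambda>\<epsilon>. - (s \<epsilon> * \<bar>ln \<epsilon>\<bar>)) at_bot (at_right 0)"
      by (simp add: filterlim_uminus_at_bot)
    then have "\<rho> = 0"
      by (intro \<rho>_unique filterlim_compose[OF exp_at_bot])
    then show ?thesis
      by (intro lim film_profile_limit_rho_0[OF s s0 \<rho>] q)
  qed
  moreover have "0 < \<rho> \<and> \<rho> < 1 \<and> ((\<lambda>\<epsilon>. ennreal (1 / scaling \<rho> (s \<epsilon>) \<epsilon>) * G \<epsilon>) \<longlongrightarrow> ennreal ((1 - \<rho>\<^sup>2) / \<rho>\<^sup>2 * S)) (at_right 0)"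
    if comp: "comparable_inverse_log s"
  proof -
    obtain c where c: "c > 0" "((\<lambda>\<epsilon>. s \<epsilon> * \<bar>ln \<epsilon>\<bar>) \<longlongrightarrow> c) (at_right 0)"
      using comp by (auto simp: comparable_inverse_log_def)
    have "\<rho> = exp (- c)"
      by (intro \<rho>_unique tendsto_intros c)
    then have "0 < \<rho>" "\<rho> < 1"
      using c by auto
    then show ?thesis
      by (intro conjI lim film_profile_limit_rho_between[OF s s0 \<rho>] q)
  qed
  moreover have "((\<lambda>\<epsilon>. ennreal (1 / scaling \<rho> (s \<epsilon>) \<epsilon>) * G \<epsilon>) \<longlongrightarrow> ennreal (2 * S)) (at_right 0)"
    if "much_greater (\<lambda>\<epsilon>. 1 / \<bar>ln \<epsilon>\<bar>) s"
  proof -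
    have log: "((\<lambda>\<epsilon>. s \<epsilon> * \<bar>ln \<epsilon>\<bar>) \<longlongrightarrow> 0) (at_right 0)"
      using that by (simp add: much_greater_def)
    then have "((\<lambda>\<epsilon>. exp (- (s \<epsilon> * \<bar>ln \<epsilon>\<bar>))) \<longlongrightarrow> exp (- 0)) (at_right 0)"
      by (intro tendsto_intros)
    then have "\<rho> = 1"
      by (intro \<rho>_unique) simp
    then show ?thesis
      by (intro lim film_profile_limit_rho_1[OF s s0 \<rho>] q log)
  qed
  ultimately show ?thesis
    unfolding jumps G_def[symmetric] by blast
qed

end
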